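(* Let $k\geq 1$ and let $(j_1,\ldots,j_r)$ be a partition of $k$, i.e. integers $j_1\geq\cdots\geq j_r\geq 1$ with $j_1+\cdots+j_r=k$. Let $h_{j_1,\ldots,j_r}$ be the coefficient of $p_{j_1}\cdots p_{j_r}$ in the $k$th Hirzebruch $L$-polynomial $L_k(p_1,\ldots,p_k)$. Then $$h_{j_1,\ldots,j_r} = \frac{(-1)^r}{\alpha_1!\cdots \alpha_k!}\, \frac{2^{2k}}{\pi^{2k}}\, T^\Sigma(2j_1,\ldots,2 j_r),$$ where, for $1\le \ell\le k$, $\alpha_\ell$ is the number of $j_1,\ldots,j_r$ that are equal to $\ell$.
   Context: The Hirzebruch $L$-polynomials $L_k=L_k(p_1,\ldots,p_k)$ are the polynomials with rational coefficients in indeterminates $p_1,p_2,\ldots$ forming the multiplicative sequence with characteristic power series $Q(z)=\frac{\sqrt z}{\tanh\sqrt z}\in\mathbb{Q}[[z]]$. Explicitly, for any $m\geq k$, if $p_i$ is replaced by the $i$th elementary symmetric polynomial in $x_1,\ldots,x_m$, then $L_k(p_1,\ldots,p_k)$ is the homogeneous degree $k$ part of $Q(x_1)\cdots Q(x_m)$; this determines $L_k$ uniquely. For example $L_1=\frac13 p_1$, $L_2=\frac1{45}(7p_2-p_1^2)$, $L_3=\frac{1}{945}(62p_3-13p_2p_1+2p_1^3)$. One writes $L_k=\sum h_{j_1,\ldots,j_r}p_{j_1}\cdots p_{j_r}$, the sum being over all partitions $(j_1,\ldots,j_r)$ of $k$. For real numbers $s_1,\ldots,s_r>1$, define $$T(s_1,\ldots,s_r)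 = \sum_{n_1\geq_2 \cdots \geq_2 n_r\geq 1} \frac{(-1)^{n_1+\cdots + n_r}}{n_1^{s_1}\cdots n_r^{s_r}},$$ where the $n_i$ are integers and $n\geq_2 m$ means "$n\geq m$, with equality only if $n$ is even". The symmetrization is $$T^\Sigma(s_1,\ldots, s_r) = \sum_{\sigma\in \Sigma_r} T(s_{\sigma_1},\ldots,s_{\sigma_r}),$$ where $\Sigma_r$ is the symmetric group on $\{1,\ldots,r\}$. *)

theory Defs
  imports
    "HOL-Analysis.Analysis"
    "HOL-Library.Poly_Mapping"
    "HOL-Computational_Algebra.Formal_Power_Series"
    "HOL-Combinatorics.Permutations"
begin

text \<open>
  Polynomials in countably many indeterminates, indexed by \<^typ>\<open>nat\<close>, with rational
  coefficients: finitely supported maps from exponent vectors to coefficients, with the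
  convolution product of \<^theory>\<open>HOL-Library.Poly_Mapping\<close>.
\<close>

type_synonym monom = "nat \<Rightarrow>\<^sub>0 nat"
type_synonym rat_mpoly = "monom \<Rightarrow>\<^sub>0 rat"

definition mpoly_const :: "rat \<Rightarrow> rat_mpoly" where
  "mpoly_const c = Poly_Mapping.single 0 c"

definition mpoly_var :: "nat \<Rightarrow> rat_mpoly" where
  "mpoly_var i = Poly_Mapping.single (Poly_Mapping.single i 1) 1"

definition mpoly_subst :: "(nat \<Rightarrow> rat_mpoly) \<Rightarrow> rat_mpoly \<Rightarrow> rat_mpoly" where
  "mpoly_subst s P =
     (\<Sum>a\<in>Poly_Mapping.keys P. mpoly_const (Poly_Mapping.lookup P a) *
        (\<Prod>i\<in>Poly_Mapping.keys a. s i ^ Poly_Mapping.lookup a i))"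

definition elem_sym :: "nat \<Rightarrow> nat \<Rightarrow> rat_mpoly" where
  "elem_sym m i = (\<Sum>S | S \<subseteq> {1..m} \<and> card S = i. \<Prod>j\<in>S. mpoly_var j)"

text \<open>
  The series \<open>Q(z) = sqrt z / tanh (sqrt z)\<close>, written as the quotient of
  \<open>cosh (sqrt z) = (\<Sum>n. z ^ n / (2 n)!)\<close> by
  \<open>sinh (sqrt z) / sqrt z = (\<Sum>n. z ^ n / (2 n + 1)!)\<close>. The lemma below is the
  identity \<open>Q(t\<^sup>2) * sinh t = t * cosh t\<close>, up to a factor 2 on both sides.
\<close>

definition hirzebruch_Q :: "rat fps" where
  "hirzebruch_Q = Abs_fps (\<lambda>n. 1 / fact (2 * n)) / Abs_fps (\<lambda>n. 1 / fact (2 * n + 1))"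

lemma hirzebruch_Q_compose_square:
  "(hirzebruch_Q oo fps_X\<^sup>2) * (fps_exp 1 - fps_exp (-1)) = fps_X * (fps_exp 1 + fps_exp (-1))"
proof -
  define C S :: "rat fps" where "C = Abs_fps (\<lambda>n. 1 / fact (2 * n))"
    and "S = Abs_fps (\<lambda>n. 1 / fact (2 * n + 1))"
  have X2: "fps_nth (F oo fps_X\<^sup>2) n = (if even n then fps_nth F (n div 2) else 0)"
    for F :: "rat fps" and n
  proof -
    have "fps_nth (F oo fps_X\<^sup>2) n = (\<Sum>i=0..n. fps_nth F i * (if n = 2 * i then 1 else 0))"
      by (simp add: fps_compose_nth power_mult [symmetric] fps_X_power_nth)
    also have "\<dots> = (\<Sum>i\<in>{0..n}. if n = 2 * i then fps_nth F i else 0)"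
      by (rule sum.cong) auto
    also have "\<dots> = (\<Sum>i\<in>{i\<in>{0..n}. n = 2 * i}. fps_nth F i)"
      by (subst sum.inter_filter) auto
    also have "\<dots> = (if even n then fps_nth F (n div 2) else 0)"
    proof (cases "even n")
      case True
      hence "{i\<in>{0..n}. n = 2 * i} = {n div 2}" by auto
      thus ?thesis using True by simp
    next
      case False
      hence "{i\<in>{0..n}. n = 2 * i} = {}" by auto
      thus ?thesis by (simp only: False sum.empty if_False)
    qed
    finally show ?thesis .
  qed
  have S0: "fps_nth S 0 \<noteq> 0" by (simp add: S_def)
  have QS: "hirzebruch_Q * S = C"
    using S0 unfolding hirzebruch_Q_def C_def [symmetric] S_def [symmetric]
    by (simp add: fps_divide_unit mult.assoc inverse_mult_eq_1)
  have "(hirzebruch_Q oo fps_X\<^sup>2) * (S oo fps_X\<^sup>2) = C oo fps_X\<^sup>2"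
    by (subst fps_compose_mult_distrib [symmetric]) (simp_all add: QS)
  moreover have "fps_exp 1 - fps_exp (-1) = 2 * fps_X * (S oo fps_X\<^sup>2)"
  proof (rule fps_ext)
    fix n
    show "fps_nth (fps_exp 1 - fps_exp (-1)) n = fps_nth (2 * fps_X * (S oo fps_X\<^sup>2)) n"
      by (cases n) (auto simp: X2 S_def mult.assoc fps_numeral_nth
          numeral_fps_const algebra_simps elim!: oddE evenE)
  qed
  moreover have "fps_exp 1 + fps_exp (-1) = 2 * (C oo fps_X\<^sup>2)"
    by (rule fps_ext) (auto simp: X2 C_def numeral_fps_const elim!: evenE)
  ultimately show ?thesis
    by (simp add: algebra_simps)
qed

text \<open>
  The homogeneous part of degree \<open>k\<close> of \<open>Q(x\<^sub>1) \<cdots> Q(x\<^sub>m)\<close> is the coefficient of \<open>t ^ k\<close> in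
  \<open>Q(t x\<^sub>1) \<cdots> Q(t x\<^sub>m)\<close>, a power series in \<open>t\<close> over the polynomial ring. Its coefficients
  are computed below.
\<close>

definition hirzebruch_part :: "nat \<Rightarrow> nat \<Rightarrow> rat_mpoly" where
  "hirzebruch_part m k =
     fps_nth (\<Prod>i=1..m. Abs_fps (\<lambda>n. mpoly_const (fps_nth hirzebruch_Q n) * mpoly_var i ^ n)) k"

lemma mpoly_var_power: "mpoly_var i ^ n = Poly_Mapping.single (Poly_Mapping.single i n) 1"
  by (induction n)
     (simp_all add: mpoly_var_def mult_single single_add [symmetric] single_one)

lemma lookup_mult_single:
  fixes P :: rat_mpoly
  shows "Poly_Mapping.lookup (P * Poly_Mapping.single (Poly_Mapping.single i n) c) a =
     (if n \<le> Poly_Mapping.lookup a i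
      then Poly_Mapping.lookup P (a - Poly_Mapping.single i n) * c else 0)"
proof -
  let ?b = "Poly_Mapping.single i n"
  have inner: "(\<Sum>q. Poly_Mapping.lookup (Poly_Mapping.single ?b c) q when a = l + q)
      = (c when a = l + ?b)" for l
  proof -
    have "(\<lambda>q. Poly_Mapping.lookup (Poly_Mapping.single ?b c) q when a = l + q)
        = (\<lambda>q. (c when a = l + ?b) when q = ?b)"
      by (auto simp: fun_eq_iff lookup_single when_def)
    thus ?thesis by (simp only: Sum_any_when_equal)
  qed
  have eq: "a = l + ?b \<longleftrightarrow> n \<le> Poly_Mapping.lookup a i \<and> l = a - ?b" for l
  proof
    assume "a = l + ?b"
    thus "n \<le> Poly_Mapping.lookup a i \<and> l = a - ?b" by (simp add: lookup_add)
  next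
    assume "n \<le> Poly_Mapping.lookup a i \<and> l = a - ?b"
    thus "a = l + ?b"
      by (auto intro!: poly_mapping_eqI simp: lookup_add lookup_minus lookup_single when_def)
  qed
  show ?thesis
    by (simp add: lookup_mult inner eq mult_when)
qed

lemma lookup_hirzebruch_part:
  "Poly_Mapping.lookup (hirzebruch_part m k) a =
     (if Poly_Mapping.keys a \<subseteq> {1..m} \<and> (\<Sum>i=1..m. Poly_Mapping.lookup a i) = k
      then \<Prod>i=1..m. fps_nth hirzebruch_Q (Poly_Mapping.lookup a i) else 0)"
proof (induction m arbitrary: k a)
  case 0
  show ?case
    by (auto simp: hirzebruch_part_def lookup_one when_def)
next
  case (Suc m)
  let ?l = "Poly_Mapping.lookup" and ?i = "Suc m" and ?q = "fps_nth hirzebruch_Q"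
  let ?n = "?l a ?i"
  have Q: "mpoly_const c * mpoly_var i ^ n = Poly_Mapping.single (Poly_Mapping.single i n) c"
    for c i n
    by (simp add: mpoly_const_def mpoly_var_power mult_single)
  have "hirzebruch_part ?i k = (\<Sum>j=0..k. hirzebruch_part m j *
      Poly_Mapping.single (Poly_Mapping.single ?i (k - j)) (?q (k - j)))"
    by (simp add: hirzebruch_part_def fps_mult_nth Q)
  hence "?l (hirzebruch_part ?i k) a = (\<Sum>j=0..k. if k - j \<le> ?n
      then ?l (hirzebruch_part m j) (a - Poly_Mapping.single ?i (k - j)) * ?q (k - j) else 0)"
    by (simp add: lookup_sum lookup_mult_single)
  also have "\<dots> = (\<Sum>j=0..k. if j + ?n = k
      then ?l (hirzebruch_part m j) (a - Poly_Mapping.single ?i ?n) * ?q ?n else 0)"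
  proof (intro sum.cong refl, goal_cases)
    case (1 j)
    show ?case
    proof (cases "j + ?n = k")
      case True
      thus ?thesis by auto
    next
      case False
      have "?i \<in> Poly_Mapping.keys (a - Poly_Mapping.single ?i (k - j))" if "k - j \<le> ?n"
        using that False 1 by (auto simp: in_keys_iff lookup_minus)
      hence "\<not> Poly_Mapping.keys (a - Poly_Mapping.single ?i (k - j)) \<subseteq> {1..m}" if "k - j \<le> ?n"
        using that by fastforce
      thus ?thesis using False by (simp add: Suc.IH)
    qed
  qed
  also have "\<dots> = (if ?n \<le> k then ?l (hirzebruch_part m (k - ?n))
      (a - Poly_Mapping.single ?i ?n) * ?q ?n else 0)"
  proof (cases "?n \<le> k")
    case True
    hence "(j + ?n = k) = (j = k - ?n)" for j by auto
    thus ?thesis using True by (simp add: sum.delta)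
  next
    case False
    thus ?thesis by (auto intro!: sum.neutral)
  qed
  also have "\<dots> = (if Poly_Mapping.keys a \<subseteq> {1..?i} \<and> (\<Sum>i=1..?i. ?l a i) = k
      then \<Prod>i=1..?i. ?q (?l a i) else 0)"
  proof -
    define b where "b = a - Poly_Mapping.single ?i ?n"
    have lb: "?l b i = (if i = ?i then 0 else ?l a i)" for i
      by (simp add: b_def lookup_minus lookup_single when_def)
    have "Poly_Mapping.keys b = Poly_Mapping.keys a - {?i}"
      by (auto simp: in_keys_iff lb split: if_splits)
    hence K: "Poly_Mapping.keys b \<subseteq> {1..m} \<longleftrightarrow> Poly_Mapping.keys a \<subseteq> {1..?i}"
      by (auto simp: subset_iff le_Suc_eq)
    have "(\<Sum>i=1..m. ?l b i) = (\<Sum>i=1..m. ?l a i)" "(\<Prod>i=1..m. ?q (?l b i)) = (\<Prod>i=1..m. ?q (?l a i))"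
      by (auto intro!: sum.cong prod.cong simp: lb)
    hence "?l (hirzebruch_part m (k - ?n)) b = (if Poly_Mapping.keys a \<subseteq> {1..?i} \<and>
        (\<Sum>i=1..m. ?l a i) = k - ?n then \<Prod>i=1..m. ?q (?l a i) else 0)"
      by (simp only: Suc.IH K)
    thus ?thesis unfolding b_def [symmetric]
      by (cases "Poly_Mapping.keys a \<subseteq> {1..?i}") auto
  qed
  finally show ?case .
qed

definition is_hirzebruch_L :: "nat \<Rightarrow> rat_mpoly \<Rightarrow> bool" where
  "is_hirzebruch_L k L \<longleftrightarrow>
     (\<forall>a\<in>Poly_Mapping.keys L. Poly_Mapping.keys a \<subseteq> {1..k}) \<and>
     (\<forall>m\<ge>k. mpoly_subst (elem_sym m) L = hirzebruch_part m k)"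

definition hirzebruch_L :: "nat \<Rightarrow> rat_mpoly" where
  "hirzebruch_L k = (THE L. is_hirzebruch_L k L)"

text \<open>The coefficient of \<open>p\<^sub>j\<^sub>1 \<cdots> p\<^sub>j\<^sub>r\<close>, where \<open>js = [j\<^sub>1, \<dots>, j\<^sub>r]\<close>.\<close>

definition hirzebruch_coeff :: "nat \<Rightarrow> nat list \<Rightarrow> rat" where
  "hirzebruch_coeff k js =
     Poly_Mapping.lookup (hirzebruch_L k)
       (\<Sum>j\<leftarrow>js. Poly_Mapping.single j 1)"

definition geq2 :: "nat \<Rightarrow> nat \<Rightarrow> bool" where
  "geq2 n m \<longleftrightarrow> n \<ge> m \<and> (n = m \<longrightarrow> even n)"

definition T_index :: "nat \<Rightarrow> nat list set" where
  "T_index r = {ns. length ns = r \<and> successively geq2 ns \<and> (\<forall>n\<in>set ns. n \<ge> 1)}"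

definition T :: "real list \<Rightarrow> real" where
  "T s = (\<Sum>\<^sub>\<infinity>ns\<in>T_index (length s).
     (-1) ^ sum_list ns / (\<Prod>i<length s. real (ns ! i) powr (s ! i)))"

definition T_Sigma :: "real list \<Rightarrow> real" where
  "T_Sigma s = (\<Sum>\<sigma> | \<sigma> permutes {..<length s}. T (permute_list \<sigma> s))"

definition is_partition :: "nat \<Rightarrow> nat list \<Rightarrow> bool" where
  "is_partition k js \<longleftrightarrow> sorted_wrt (\<ge>) js \<and> (\<forall>j\<in>set js. j \<ge> 1) \<and> sum_list js = k"

end

theory Submission
  imports
    Defs
    "HOL-Combinatorics.Multiset_Permutations"
    "HOL-Computational_Algebra.Fundamental_Theorem_Algebra"
begin

text \<open>
  The sums \<open>T\<close> arise by multiplying out an infinite product. Let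
  \<open>S(z) = sinh (sqrt z) / sqrt z = \<Prod>n\<ge>1. (1 + z / (\<pi> n)\<^sup>2)\<close> and \<open>a\<^sub>n = 4 / (\<pi> n)\<^sup>2\<close>. From
  \<open>sinh (2 w) = 2 sinh w cosh w\<close> one gets \<open>Q(z) S(z)\<^sup>2 = S(4 z)\<close>; here \<open>S(z)\<close> is the product of
  \<open>1 + a\<^sub>n z\<close> over the even \<open>n\<close> and \<open>S(4 z)\<close> the product over all \<open>n\<close>, so that
  \<open>Q(z) = (\<Prod>n odd. 1 + a\<^sub>n z) / (\<Prod>n even. 1 + a\<^sub>n z)\<close>.

  Replace \<open>z\<close> by \<open>x\<^sub>i t\<close> and multiply over \<open>i\<close>. With \<open>E(c) = \<Prod>i. (1 + c x\<^sub>i t) = \<Sum>j. c ^ j e\<^sub>j t ^ j\<close>, where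
  \<open>e\<^sub>j\<close> is the elementary symmetric polynomial, the series \<open>Q(x\<^sub>1 t) \<cdots> Q(x\<^sub>m t)\<close> becomes the product
  over \<open>n\<close> of \<open>E(a\<^sub>n)\<close> for odd \<open>n\<close> and \<open>1 / E(a\<^sub>n)\<close> for even \<open>n\<close>. Multiplying this out with \<open>n\<close>
  decreasing, an odd \<open>n\<close> contributes at most one factor \<open>a\<^sub>n ^ j e\<^sub>j\<close>, while an even \<open>n\<close> contributes
  any number of factors \<open>- a\<^sub>n ^ j e\<^sub>j\<close>. The choices that give the word \<open>e\<^bsub>s\<^sub>1\<^esub> \<cdots> e\<^bsub>s\<^sub>r\<^esub>\<close> are therefore
  exactly the chains \<open>n\<^sub>1 \<ge>\<^sub>2 \<cdots> \<ge>\<^sub>2 n\<^sub>r\<close>, and the sign of a chain is \<open>-1\<close> to the number of its even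
  entries, that is \<open>(-1) ^ r (-1) ^ (n\<^sub>1 + \<cdots> + n\<^sub>r)\<close>. Hence the word has the coefficient
  \<open>(-1) ^ r (4 / \<pi>\<^sup>2) ^ k T(2 s\<^sub>1, \<dots>, 2 s\<^sub>r)\<close>. The multiplication is carried out on the finite
  products over \<open>n \<le> 2 N\<close> (lemmas \<open>T_series_step\<close> and \<open>T_series_mult_sinhc_partial\<close>), and the
  limit \<open>N \<rightarrow> \<infinity>\<close> is taken coefficient by coefficient in \<open>sum_compositions_T_eq_hirzebruch_part\<close>.

  Collecting the words with the same commutative monomial \<open>J\<close> gives a real coefficient \<open>L_coeff k J\<close>
  such that the polynomial with these coefficients, evaluated at the elementary symmetric functions
  of any point, is the degree \<open>k\<close> part of \<open>Q(x\<^sub>1) \<cdots> Q(x\<^sub>m)\<close>. Over the complex numbers every vector is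
  \<open>(e\<^sub>1, \<dots>, e\<^sub>k)\<close> of some point, by the fundamental theorem of algebra, so every rational solution \<open>L\<close>
  of the defining equations of the \<open>L\<close>-polynomial has the coefficients \<open>L_coeff k J\<close>
  (\<open>is_hirzebruch_L_lookup\<close>). That a rational solution exists follows by applying a \<open>\<rat>\<close>-linear
  retraction \<open>\<real> \<rightarrow> \<rat>\<close> to the real one (\<open>exists_hirzebruch_L\<close>). Finally, the words with the monomial
  of a partition are its rearrangements, and the symmetrization runs through each of them
  \<open>\<alpha>\<^sub>1! \<cdots> \<alpha>\<^sub>k!\<close> times (\<open>sum_permute_list\<close>).
\<close>

section \<open>Evaluation of polynomials at points of a field\<close>

definition monom_eval :: "(nat \<Rightarrow> 'a::field_char_0) \<Rightarrow> monom \<Rightarrow> 'a" where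
  "monom_eval x a = (\<Prod>i\<in>Poly_Mapping.keys a. x i ^ Poly_Mapping.lookup a i)"

definition mpoly_eval :: "(nat \<Rightarrow> 'a::field_char_0) \<Rightarrow> rat_mpoly \<Rightarrow> 'a" where
  "mpoly_eval x P =
     (\<Sum>a\<in>Poly_Mapping.keys P. of_rat (Poly_Mapping.lookup P a) * monom_eval x a)"

lemma monom_eval_superset:
  assumes "finite S" "Poly_Mapping.keys a \<subseteq> S"
  shows "monom_eval x a = (\<Prod>i\<in>S. x i ^ Poly_Mapping.lookup a i)"
  unfolding monom_eval_def using assms
  by (intro prod.mono_neutral_left) (auto simp: in_keys_iff)

lemma monom_eval_0 [simp]: "monom_eval x 0 = 1"
  by (simp add: monom_eval_def)

lemma monom_eval_single [simp]: "monom_eval x (Poly_Mapping.single i n) = x i ^ n"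
  by (cases "n = 0") (simp_all add: monom_eval_def)

lemma monom_eval_add: "monom_eval x (a + b) = monom_eval x a * monom_eval x b"
proof -
  let ?S = "Poly_Mapping.keys a \<union> Poly_Mapping.keys b"
  have "finite ?S" by simp
  moreover have "Poly_Mapping.keys (a + b) \<subseteq> ?S" by (rule Poly_Mapping.keys_add)
  ultimately show ?thesis
    by (subst (1 2 3) monom_eval_superset[of ?S])
      (auto simp: lookup_add power_add prod.distrib)
qed

lemma monom_eval_of_rat: "monom_eval (\<lambda>i. of_rat (x i)) a = of_rat (monom_eval x a)"
  by (simp add: monom_eval_def of_rat_prod of_rat_power)

lemma mpoly_eval_superset:
  assumes "finite S" "Poly_Mapping.keys P \<subseteq> S"
  shows "mpoly_eval x P = (\<Sum>a\<in>S. of_rat (Poly_Mapping.lookup P a) * monom_eval x a)"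
  unfolding mpoly_eval_def using assms
  by (intro sum.mono_neutral_left) (auto simp: in_keys_iff)

lemma mpoly_eval_0 [simp]: "mpoly_eval x 0 = 0"
  by (simp add: mpoly_eval_def)

lemma mpoly_eval_single [simp]:
  "mpoly_eval x (Poly_Mapping.single a c) = of_rat c * monom_eval x a"
  by (cases "c = 0") (simp_all add: mpoly_eval_def)

lemma mpoly_eval_1 [simp]: "mpoly_eval x 1 = 1"
  using mpoly_eval_single[of x 0 1] by (simp del: mpoly_eval_single)

lemma mpoly_eval_add: "mpoly_eval x (P + Q) = mpoly_eval x P + mpoly_eval x Q"
proof -
  let ?S = "Poly_Mapping.keys P \<union> Poly_Mapping.keys Q"
  have "finite ?S" by simp
  moreover have "Poly_Mapping.keys (P + Q) \<subseteq> ?S" by (rule Poly_Mapping.keys_add)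
  ultimately show ?thesis
    by (subst (1 2 3) mpoly_eval_superset[of ?S])
      (auto simp: lookup_add of_rat_add ring_distribs sum.distrib)
qed

lemma mpoly_eval_sum: "mpoly_eval x (\<Sum>i\<in>I. P i) = (\<Sum>i\<in>I. mpoly_eval x (P i))"
  by (induction I rule: infinite_finite_induct) (auto simp: mpoly_eval_add)

lemma sum_monomials_eq:
  fixes P :: rat_mpoly
  shows "(\<Sum>a\<in>Poly_Mapping.keys P. Poly_Mapping.single a (Poly_Mapping.lookup P a)) = P"
proof (rule poly_mapping_eqI)
  fix b
  have "Poly_Mapping.lookup
      (\<Sum>a\<in>Poly_Mapping.keys P. Poly_Mapping.single a (Poly_Mapping.lookup P a)) b =
      (\<Sum>a\<in>Poly_Mapping.keys P. if a = b then Poly_Mapping.lookup P a else 0)"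
    unfolding lookup_sum by (intro sum.cong refl) (auto simp: lookup_single when_def)
  also have "\<dots> = Poly_Mapping.lookup P b"
    by (auto simp: in_keys_iff)
  finally show "Poly_Mapping.lookup
      (\<Sum>a\<in>Poly_Mapping.keys P. Poly_Mapping.single a (Poly_Mapping.lookup P a)) b =
      Poly_Mapping.lookup P b" .
qed

lemma mpoly_eval_mult: "mpoly_eval x (P * Q) = mpoly_eval x P * mpoly_eval x Q"
proof -
  let ?l = Poly_Mapping.lookup and ?K = Poly_Mapping.keys
  have "P * Q = (\<Sum>a\<in>?K P. Poly_Mapping.single a (?l P a)) * (\<Sum>b\<in>?K Q. Poly_Mapping.single b (?l Q b))"
    by (simp only: sum_monomials_eq)
  also have "\<dots> = (\<Sum>a\<in>?K P. \<Sum>b\<in>?K Q. Poly_Mapping.single (a + b) (?l P a * ?l Q b))"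
    by (simp add: sum_product mult_single)
  also have "mpoly_eval x \<dots> = mpoly_eval x P * mpoly_eval x Q"
    by (simp add: mpoly_eval_sum monom_eval_add of_rat_mult mpoly_eval_def[of x P] mpoly_eval_def[of x Q]
        sum_product mult_ac)
  finally show ?thesis .
qed

lemma mpoly_eval_power: "mpoly_eval x (P ^ n) = mpoly_eval x P ^ n"
  by (induction n) (auto simp: mpoly_eval_mult)

lemma mpoly_eval_prod: "mpoly_eval x (\<Prod>i\<in>I. P i) = (\<Prod>i\<in>I. mpoly_eval x (P i))"
  by (induction I rule: infinite_finite_induct) (auto simp: mpoly_eval_mult)

lemma mpoly_eval_const [simp]: "mpoly_eval x (mpoly_const c) = of_rat c"
  by (simp add: mpoly_const_def)

lemma mpoly_eval_var [simp]: "mpoly_eval x (mpoly_var i) = x i"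
  by (simp add: mpoly_var_def)

text \<open>
  Evaluation turns the substitution in the definition of the \<open>L\<close>-polynomials into evaluation at
  the values of the elementary symmetric polynomials. This is what allows identities between
  polynomials to be treated as identities between numbers.
\<close>

lemma mpoly_eval_subst: "mpoly_eval x (mpoly_subst s P) = mpoly_eval (\<lambda>i. mpoly_eval x (s i)) P"
  by (simp add: mpoly_subst_def mpoly_eval_sum mpoly_eval_mult mpoly_eval_prod mpoly_eval_power
      mpoly_eval_def[of _ P] monom_eval_def)

definition esym_eval :: "nat \<Rightarrow> (nat \<Rightarrow> 'a::field_char_0) \<Rightarrow> nat \<Rightarrow> 'a" where
  "esym_eval m x i = (\<Sum>S | S \<subseteq> {1..m} \<and> card S = i. \<Prod>j\<in>S. x j)"

lemma mpoly_eval_elem_sym: "mpoly_eval x (elem_sym m i) = esym_eval m x i"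
  by (simp add: elem_sym_def esym_eval_def mpoly_eval_sum mpoly_eval_prod)

lemma esym_eval_of_rat: "esym_eval m (\<lambda>i. of_rat (x i)) j = of_rat (esym_eval m x j)"
  by (simp add: esym_eval_def of_rat_sum of_rat_prod)

lemma mpoly_eval_fps_prod:
  "mpoly_eval x (fps_nth (\<Prod>i\<in>I. F i) k) =
     fps_nth (\<Prod>i\<in>I. Abs_fps (\<lambda>n. mpoly_eval x (fps_nth (F i) n))) k"
proof (induction I arbitrary: k rule: infinite_finite_induct)
  case (insert i I)
  then show ?case
    by (simp add: fps_mult_nth mpoly_eval_sum mpoly_eval_mult)
qed auto

lemma mpoly_eval_hirzebruch_part:
  "mpoly_eval x (hirzebruch_part m k) =
     fps_nth (\<Prod>i=1..m. Abs_fps (\<lambda>n. of_rat (fps_nth hirzebruch_Q n) * x i ^ n)) k"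
  unfolding hirzebruch_part_def mpoly_eval_fps_prod
  by (simp add: mpoly_eval_mult mpoly_eval_power)

section \<open>Linear independence of monomials\<close>

text \<open>
  Induction on the number of variables: for fixed values of the first \<open>n\<close> variables the sum is a
  polynomial in the last one with infinitely many zeros, so for each exponent \<open>d\<close> of the last
  variable the terms with that exponent cancel among themselves. Indexing the monomials by an
  abstract set, with exponents that need only be distinct on the variables in use, lets the
  induction hypothesis apply to these terms without changing them.
\<close>

lemma monomials_linearly_independent:
  fixes c :: "'i \<Rightarrow> 'a::field_char_0" and e :: "'i \<Rightarrow> nat \<Rightarrow> nat"
  assumes "finite A"
    and "\<And>a b. \<lbrakk>a \<in> A; b \<in> A; \<forall>i<n. e a i = e b i\<rbrakk> \<Longrightarrow> a = b"
    and "\<And>x. (\<Sum>a\<in>A. c a * (\<Prod>i<n. x i ^ e a i)) = 0"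
    and "a \<in> A"
  shows "c a = 0"
  using assms
proof (induction n arbitrary: A a)
  case 0
  then have "A = {a}" by auto
  with 0(3) show ?case by simp
next
  case (Suc n)
  define B where "B d = {b\<in>A. e b n = d}" for d
  define N where "N = Max ((\<lambda>b. e b n) ` A)"
  have le_N: "e b n \<le> N" if "b \<in> A" for b
    using Suc.prems(1) that by (simp add: N_def)
  have zero: "(\<Sum>b\<in>B d. c b * (\<Prod>i<n. x i ^ e b i)) = 0" if "d \<le> N" for x d
  proof -
    define f where "f d = (\<Sum>b\<in>B d. c b * (\<Prod>i<n. x i ^ e b i))" for d
    have "(\<Sum>d\<le>N. f d * y ^ d) = 0" for y
    proof -
      define z where "z = x(n := y)"
      have "0 = (\<Sum>b\<in>A. c b * (\<Prod>i<Suc n. z i ^ e b i))"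
        using Suc.prems(3) by simp
      also have "\<dots> = (\<Sum>b\<in>A. c b * (\<Prod>i<n. x i ^ e b i) * y ^ e b n)"
      proof (intro sum.cong refl)
        fix b
        have "(\<Prod>i<n. z i ^ e b i) = (\<Prod>i<n. x i ^ e b i)"
          by (intro prod.cong) (auto simp: z_def)
        thus "c b * (\<Prod>i<Suc n. z i ^ e b i) = c b * (\<Prod>i<n. x i ^ e b i) * y ^ e b n"
          by (simp add: z_def)
      qed
      also have "\<dots> = (\<Sum>d\<le>N. \<Sum>b | b \<in> A \<and> e b n = d. c b * (\<Prod>i<n. x i ^ e b i) * y ^ e b n)"
        using Suc.prems(1) le_N by (intro sum.group[symmetric]) auto
      also have "\<dots> = (\<Sum>d\<le>N. f d * y ^ d)"
        by (simp add: f_def B_def sum_distrib_right)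
      finally show ?thesis by simp
    qed
    hence "poly (\<Sum>d\<le>N. monom (f d) d) y = 0" for y
      by (simp add: poly_sum poly_monom)
    hence "(\<Sum>d\<le>N. monom (f d) d) = 0"
      using poly_all_0_iff_0 by blast
    hence "coeff (\<Sum>d\<le>N. monom (f d) d) d = 0" by simp
    with that show ?thesis by (simp add: f_def coeff_sum sum.delta)
  qed
  show ?case
  proof (rule Suc.IH[of "B (e a n)"])
    show "finite (B (e a n))" using Suc.prems(1) by (simp add: B_def)
    show "a' = b'" if "a' \<in> B (e a n)" "b' \<in> B (e a n)" "\<forall>i<n. e a' i = e b' i" for a' b'
      using that by (intro Suc.prems(2)) (auto simp: B_def less_Suc_eq)
    show "a \<in> B (e a n)" using Suc.prems(4) by (simp add: B_def)
    show "(\<Sum>b\<in>B (e a n). c b * (\<Prod>i<n. x i ^ e b i)) = 0" for x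
      using zero[OF le_N[OF Suc.prems(4)]] .
  qed
qed

lemma monom_evals_linearly_independent:
  fixes c :: "monom \<Rightarrow> 'a::field_char_0"
  assumes A: "finite A" and zero: "\<And>x. (\<Sum>a\<in>A. c a * monom_eval x a) = 0" and "a \<in> A"
  shows "c a = 0"
proof -
  have "finite (\<Union>a\<in>A. Poly_Mapping.keys a)" using A by simp
  then obtain n where n: "(\<Union>a\<in>A. Poly_Mapping.keys a) \<subseteq> {..<n}"
    using finite_nat_iff_bounded by auto
  have keys: "Poly_Mapping.keys a \<subseteq> {..<n}" if "a \<in> A" for a using n that by auto
  show ?thesis
  proof (rule monomials_linearly_independent[OF A _ _ \<open>a \<in> A\<close>, of n Poly_Mapping.lookup])
    fix a b assume ab: "a \<in> A" "b \<in> A" "\<forall>i<n. Poly_Mapping.lookup a i = Poly_Mapping.lookup b i"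
    have "Poly_Mapping.lookup a i = Poly_Mapping.lookup b i" for i
    proof (cases "i < n")
      case False
      hence "i \<notin> Poly_Mapping.keys a" "i \<notin> Poly_Mapping.keys b"
        using keys ab by fastforce+
      thus ?thesis by (simp add: in_keys_iff)
    qed (use ab in auto)
    thus "a = b" by (rule poly_mapping_eqI)
  next
    fix x
    show "(\<Sum>a\<in>A. c a * (\<Prod>i<n. x i ^ Poly_Mapping.lookup a i)) = 0"
      using zero[of x] monom_eval_superset[OF _ keys, of _ x] by simp
  qed
qed

text \<open>
  Rational points suffice to tell rational polynomials apart; this matters in the existence proof,
  where only rational values can be moved past a \<open>\<rat>\<close>-linear map.
\<close>

lemma rat_mpoly_eqI:
  assumes "\<And>x :: nat \<Rightarrow> rat. mpoly_eval x P = mpoly_eval x Q"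
  shows "P = Q"
proof (rule poly_mapping_eqI)
  fix a
  let ?S = "Poly_Mapping.keys P \<union> Poly_Mapping.keys Q" and ?l = Poly_Mapping.lookup
  show "?l P a = ?l Q a"
  proof (cases "a \<in> ?S")
    case True
    have "?l P a - ?l Q a = 0"
    proof (rule monom_evals_linearly_independent[OF _ _ True])
      fix x :: "nat \<Rightarrow> rat"
      show "(\<Sum>a\<in>?S. (?l P a - ?l Q a) * monom_eval x a) = 0"
        using assms[of x] by (simp add: mpoly_eval_superset[of ?S] left_diff_distrib sum_subtractf)
    qed simp
    thus ?thesis by simp
  next
    case False
    thus ?thesis by (simp add: in_keys_iff)
  qed
qed

section \<open>Multiplying out the finite products\<close>

definition compositions :: "nat \<Rightarrow> nat list set" where
  "compositions k = {s. (\<forall>j\<in>set s. j \<ge> 1) \<and> sum_list s = k}"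

lemma compositions_0: "compositions 0 = {[]}"
proof -
  have "s = []" if "s \<in> compositions 0" for s
    using that by (cases s) (auto simp: compositions_def)
  thus ?thesis by (auto simp: compositions_def)
qed

lemma compositions_pos:
  assumes "k > 0"
  shows "compositions k = (\<Union>j\<in>{1..k}. (#) j ` compositions (k - j))" (is "_ = ?R")
proof (intro set_eqI iffI)
  fix s assume s: "s \<in> compositions k"
  then obtain j t where jt: "s = j # t" using assms by (cases s) (auto simp: compositions_def)
  with s have "j \<in> {1..k}" "t \<in> compositions (k - j)" by (auto simp: compositions_def)
  with jt show "s \<in> ?R" by blast
qed (auto simp: compositions_def)

lemma finite_compositions [simp]: "finite (compositions k)"
proof (induction k rule: less_induct)
  case (less k)
  then show ?case by (cases "k = 0") (auto simp: compositions_0 compositions_pos)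
qed

lemma sum_compositions:
  assumes "k > 0"
  shows "(\<Sum>s\<in>compositions k. f s) = (\<Sum>j=1..k. \<Sum>s\<in>compositions (k - j). f (j # s))"
proof -
  have "(\<Sum>s\<in>compositions k. f s) = (\<Sum>j=1..k. \<Sum>s\<in>(#) j ` compositions (k - j). f s)"
    unfolding compositions_pos[OF assms] by (rule sum.UNION_disjoint) auto
  also have "\<dots> = (\<Sum>j=1..k. \<Sum>s\<in>compositions (k - j). f (j # s))"
    by (simp add: sum.reindex)
  finally show ?thesis .
qed

definition T_index_upto :: "nat \<Rightarrow> nat \<Rightarrow> nat list set" where
  "T_index_upto N r = {ns \<in> T_index r. \<forall>n\<in>set ns. n \<le> N}"

lemma finite_T_index_upto [simp]: "finite (T_index_upto N r)"
  by (rule finite_subset[OF _ finite_lists_length_eq[of "{..N}" r]])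
    (auto simp: T_index_upto_def T_index_def)

lemma T_index_upto_0: "T_index_upto N 0 = {[]}"
  by (auto simp: T_index_upto_def T_index_def)

lemma geq2_trans: "geq2 a b \<Longrightarrow> geq2 b c \<Longrightarrow> geq2 a c"
  by (auto simp: geq2_def)

text \<open>
  Since \<open>\<ge>\<^sub>2\<close> is transitive, the condition on neighbours gives one on all pairs, and the head can be
  compared with the whole tail.
\<close>

lemma T_index_Cons:
  "n # ns \<in> T_index (Suc r) \<longleftrightarrow> n \<ge> 1 \<and> ns \<in> T_index r \<and> (\<forall>m\<in>set ns. geq2 n m)"
proof -
  have "sorted_wrt geq2 xs = successively geq2 xs" for xs
    by (rule successively_conv_sorted_wrt[symmetric]) (auto intro: transpI geq2_trans)
  thus ?thesis by (auto simp: T_index_def simp flip: \<open>\<And>xs. sorted_wrt geq2 xs = successively geq2 xs\<close>)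
qed

text \<open>
  A chain bounded by \<open>N + 1\<close> either avoids \<open>N + 1\<close> or starts with it. In the second case the rest of
  the chain may contain \<open>N + 1\<close> again only if \<open>N + 1\<close> is even.
\<close>

lemma T_index_upto_Suc:
  "T_index_upto (Suc N) (Suc r) =
     T_index_upto N (Suc r) \<union> (#) (Suc N) ` T_index_upto (if even (Suc N) then Suc N else N) r"
    (is "?L = ?R")
proof (intro set_eqI iffI)
  fix ms assume ms: "ms \<in> ?L"
  then obtain n ns where n: "ms = n # ns" "n # ns \<in> T_index (Suc r)" "n \<le> Suc N"
    by (cases ms) (auto simp: T_index_upto_def T_index_def)
  note T = n(2)[unfolded T_index_Cons]
  show "ms \<in> ?R"
  proof (cases "n \<le> N")
    case True
    with n T show ?thesis by (fastforce simp: T_index_upto_def geq2_def)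
  next
    case False
    with n(3) have [simp]: "n = Suc N" by simp
    have "m \<le> (if even (Suc N) then Suc N else N)" if "m \<in> set ns" for m
    proof -
      from T that have "geq2 (Suc N) m" by simp
      thus ?thesis by (cases "m = Suc N") (simp_all add: geq2_def)
    qed
    with T have "ns \<in> T_index_upto (if even (Suc N) then Suc N else N) r"
      unfolding T_index_upto_def by blast
    with n(1) show ?thesis by auto
  qed
next
  fix ms assume "ms \<in> ?R"
  then consider "ms \<in> T_index_upto N (Suc r)"
    | ns where "ms = Suc N # ns" "ns \<in> T_index_upto (if even (Suc N) then Suc N else N) r"
    by blast
  thus "ms \<in> ?L"
  proof cases
    case 1
    thus ?thesis by (fastforce simp: T_index_upto_def)
  next
    case 2
    have "geq2 (Suc N) m" "m \<le> Suc N" if "m \<in> set ns" for m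
      using 2(2) that by (auto simp: T_index_upto_def geq2_def split: if_splits)
    with 2 show ?thesis by (auto simp: T_index_upto_def T_index_Cons)
  qed
qed

definition T_weight :: "(nat \<Rightarrow> 'a::field_char_0) \<Rightarrow> nat list \<Rightarrow> nat list \<Rightarrow> 'a" where
  "T_weight a s ns = (-1) ^ sum_list ns * (\<Prod>(n, j)\<leftarrow>zip ns s. a n ^ j)"

text \<open>
  For \<open>a n = 1 / n\<^sup>2\<close> these are the partial sums of \<open>T(2 s\<^sub>1, \<dots>, 2 s\<^sub>r)\<close>.
\<close>

definition T_upto :: "(nat \<Rightarrow> 'a::field_char_0) \<Rightarrow> nat \<Rightarrow> nat list \<Rightarrow> 'a" where
  "T_upto a N s = (\<Sum>ns\<in>T_index_upto N (length s). T_weight a s ns)"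

lemma T_upto_Nil [simp]: "T_upto a N [] = 1"
  by (simp add: T_upto_def T_index_upto_0 T_weight_def)

lemma T_upto_0_Cons [simp]: "T_upto a 0 (j # s) = 0"
proof -
  have "T_index_upto 0 (length (j # s)) = {}"
    by (auto simp: T_index_upto_def T_index_def length_Suc_conv)
  thus ?thesis by (simp add: T_upto_def)
qed

lemma T_upto_Suc_Cons:
  "T_upto a (Suc N) (j # s) = T_upto a N (j # s) +
     (-1) ^ Suc N * a (Suc N) ^ j * T_upto a (if even (Suc N) then Suc N else N) s"
proof -
  let ?M = "if even (Suc N) then Suc N else N"
  have len: "length (j # s) = Suc (length s)" by simp
  have "T_upto a (Suc N) (j # s) = T_upto a N (j # s) +
      (\<Sum>ns\<in>(#) (Suc N) ` T_index_upto ?M (length s). T_weight a (j # s) ns)"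
    unfolding T_upto_def len T_index_upto_Suc
    by (rule sum.union_disjoint, simp, simp) (auto simp: T_index_upto_def)
  also have "(\<Sum>ns\<in>(#) (Suc N) ` T_index_upto ?M (length s). T_weight a (j # s) ns) =
      (-1) ^ Suc N * a (Suc N) ^ j * T_upto a ?M s"
    by (simp add: sum.reindex T_upto_def T_weight_def sum_distrib_left power_add mult_ac)
  finally show ?thesis .
qed

text \<open>
  The series \<open>E(c) = 1 + \<Sum>j\<ge>1. c ^ j e\<^sub>j t ^ j\<close> in \<open>t\<close>; the constant term is \<open>1\<close> whatever the
  value of \<open>e 0\<close>.
\<close>

definition e_series :: "(nat \<Rightarrow> 'a::field_char_0) \<Rightarrow> 'a \<Rightarrow> 'a fps" where
  "e_series e c = Abs_fps (\<lambda>j. if j = 0 then 1 else c ^ j * e j)"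

text \<open>
  Words \<open>e\<^bsub>s\<^sub>1\<^esub> \<cdots> e\<^bsub>s\<^sub>r\<^esub>\<close> of degree \<open>k\<close> correspond to compositions of \<open>k\<close>. The two lemmas
  \<open>T_series_odd\<close> and \<open>T_series_even\<close> below identify this series with the product over
  \<open>n = 1, \<dots>, N\<close> of \<open>E(a\<^sub>n)\<close> for odd \<open>n\<close> and \<open>1 / E(a\<^sub>n)\<close> for even \<open>n\<close>.
\<close>

definition T_series :: "(nat \<Rightarrow> 'a::field_char_0) \<Rightarrow> (nat \<Rightarrow> 'a) \<Rightarrow> nat \<Rightarrow> 'a fps" where
  "T_series e a N = Abs_fps (\<lambda>k. \<Sum>s\<in>compositions k.
     (-1) ^ length s * (\<Prod>j\<leftarrow>s. e j) * T_upto a N s)"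

lemma e_series_mult_nth:
  "fps_nth (e_series e c * F) k = fps_nth F k + (\<Sum>j=1..k. c ^ j * e j * fps_nth F (k - j))"
proof -
  have "fps_nth (e_series e c * F) k =
      (\<Sum>j\<in>insert 0 {1..k}. fps_nth (e_series e c) j * fps_nth F (k - j))"
    unfolding fps_mult_nth by (intro sum.cong) auto
  also have "\<dots> = fps_nth F k + (\<Sum>j=1..k. c ^ j * e j * fps_nth F (k - j))"
    by (subst sum.insert) (auto simp: e_series_def intro!: sum.cong)
  finally show ?thesis .
qed

lemma T_series_0: "T_series e a 0 = 1"
proof (rule fps_ext)
  fix k
  show "fps_nth (T_series e a 0) k = fps_nth 1 k"
    by (cases "k = 0") (simp_all add: T_series_def compositions_0 sum_compositions)
qed

text \<open>
  Passing from \<open>N\<close> to \<open>N + 1\<close> adds the chains that start with \<open>N + 1\<close>, sorted here by the first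
  exponent \<open>j\<close>. If \<open>N + 1\<close> is odd, this is a multiplication by \<open>E(a\<^bsub>N + 1\<^esub>)\<close>; if it is even, the series
  for \<open>N + 1\<close> reappears on the right with a minus sign, which is a division by \<open>E(a\<^bsub>N + 1\<^esub>)\<close>.
\<close>

lemma T_series_Suc_nth:
  "fps_nth (T_series e a (Suc N)) k = fps_nth (T_series e a N) k +
     (-1) ^ N * (\<Sum>j=1..k. a (Suc N) ^ j * e j *
        fps_nth (T_series e a (if even (Suc N) then Suc N else N)) (k - j))"
proof (cases "k = 0")
  case True
  then show ?thesis by (simp add: T_series_def compositions_0)
next
  case False
  let ?M = "if even (Suc N) then Suc N else N"
  let ?w = "\<lambda>s. (-1) ^ length s * (\<Prod>j\<leftarrow>s. e j)"
  have "fps_nth (T_series e a (Suc N)) k =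
     (\<Sum>j=1..k. \<Sum>s\<in>compositions (k - j). ?w (j # s) * T_upto a (Suc N) (j # s))"
    using False by (simp add: T_series_def sum_compositions)
  also have "\<dots> = (\<Sum>j=1..k. \<Sum>s\<in>compositions (k - j).
      ?w (j # s) * T_upto a N (j # s) + (-1) ^ N * (a (Suc N) ^ j * e j * (?w s * T_upto a ?M s)))"
    by (intro sum.cong refl, subst T_upto_Suc_Cons) (simp add: algebra_simps)
  also have "\<dots> = (\<Sum>j=1..k. \<Sum>s\<in>compositions (k - j). ?w (j # s) * T_upto a N (j # s)) +
     (-1) ^ N * (\<Sum>j=1..k. a (Suc N) ^ j * e j * (\<Sum>s\<in>compositions (k - j). ?w s * T_upto a ?M s))"
    by (simp only: sum.distrib sum_distrib_left)
  also have "\<dots> = fps_nth (T_series e a N) k + (-1) ^ N * (\<Sum>j=1..k. a (Suc N) ^ j * e j *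
        fps_nth (T_series e a ?M) (k - j))"
    using False by (simp add: T_series_def sum_compositions)
  finally show ?thesis .
qed

lemma T_series_odd:
  assumes "even N"
  shows "T_series e a (Suc N) = e_series e (a (Suc N)) * T_series e a N"
  by (rule fps_ext, subst T_series_Suc_nth) (use assms in \<open>simp add: e_series_mult_nth\<close>)

lemma T_series_even:
  assumes "odd N"
  shows "e_series e (a (Suc N)) * T_series e a (Suc N) = T_series e a N"
proof (rule fps_ext)
  fix k
  show "fps_nth (e_series e (a (Suc N)) * T_series e a (Suc N)) k = fps_nth (T_series e a N) k"
    using T_series_Suc_nth[of e a N k] assms by (simp add: e_series_mult_nth)
qed

lemma T_series_step:
  "T_series e a (2 * Suc N) * e_series e (a (2 * N + 2)) = T_series e a (2 * N) * e_series e (a (2 * N + 1))"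
  using T_series_odd[of "2 * N" e a] T_series_even[of "2 * N + 1" e a]
  by (simp add: mult.commute)

lemma fps_const_prod: "fps_const (\<Prod>i\<in>I. f i) = (\<Prod>i\<in>I. fps_const (f i))"
  by (induction I rule: infinite_finite_induct) (simp_all flip: fps_const_mult)

lemma prod_linear_eq_esym:
  fixes x :: "nat \<Rightarrow> 'a::field_char_0"
  shows "(\<Prod>i=1..m. 1 + fps_const (c * x i) * fps_X) = e_series (esym_eval m x) c"
proof (rule fps_ext)
  fix k
  have "(\<Prod>i=1..m. 1 + fps_const (c * x i) * fps_X) =
      (\<Prod>i=1..m. fps_const (c * x i) * fps_X + 1)"
    by (simp add: add.commute)
  also have "\<dots> = (\<Sum>S\<in>Pow {1..m}. fps_const (\<Prod>i\<in>S. c * x i) * fps_X ^ card S)"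
    unfolding prod_add[OF finite_atLeastAtMost]
    by (intro sum.cong refl)
       (simp only: prod.distrib[of "\<lambda>i. fps_const (c * x i)"] fps_const_prod prod_constant
          power_one mult_1_right)
  also have "fps_nth \<dots> k = (\<Sum>S\<in>Pow {1..m}. if card S = k then (\<Prod>i\<in>S. c * x i) else 0)"
    by (auto simp: fps_sum_nth fps_X_power_nth intro!: sum.cong)
  also have "\<dots> = (\<Sum>S | S \<subseteq> {1..m} \<and> card S = k. (\<Prod>i\<in>S. c * x i))"
    by (auto simp: Pow_def simp flip: sum.inter_filter intro!: sum.cong)
  also have "\<dots> = c ^ k * esym_eval m x k"
    by (simp add: esym_eval_def sum_distrib_left prod.distrib)
  also have "\<dots> = fps_nth (e_series (esym_eval m x) c) k"
  proof (cases "k = 0")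
    case True
    have "{S. S \<subseteq> {1..m} \<and> card S = 0} = {{}}"
      by (auto dest: finite_subset)
    with True show ?thesis by (simp add: e_series_def esym_eval_def)
  qed (simp add: e_series_def)
  finally show "fps_nth (\<Prod>i=1..m. 1 + fps_const (c * x i) * fps_X) k =
    fps_nth (e_series (esym_eval m x) c) k" .
qed

section \<open>Convergence of the truncated sums\<close>

lemma sum_lists_prod:
  fixes f :: "nat \<Rightarrow> nat \<Rightarrow> real"
  shows "(\<Sum>ns | set ns \<subseteq> {1..N} \<and> length ns = length s. \<Prod>(n, j)\<leftarrow>zip ns s. f n j) =
    (\<Prod>j\<leftarrow>s. \<Sum>n=1..N. f n j)"
proof (induction s)
  case Nil
  have "{ns. set ns \<subseteq> {1..N} \<and> length ns = length ([] :: nat list)} = {[]}" by auto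
  then show ?case by simp
next
  case (Cons i s)
  let ?L = "{ns. set ns \<subseteq> {1..N} \<and> length ns = length s}"
  have eq: "{ns. set ns \<subseteq> {1..N} \<and> length ns = length (i # s)} = (\<lambda>(n, ns). n # ns) ` ({1..N} \<times> ?L)"
    by (auto simp: length_Suc_conv image_iff)
  have "(\<Sum>ns | set ns \<subseteq> {1..N} \<and> length ns = length (i # s). \<Prod>(n, j)\<leftarrow>zip ns (i # s). f n j) =
      (\<Sum>(n, ns)\<in>{1..N} \<times> ?L. f n i * (\<Prod>(n, j)\<leftarrow>zip ns s. f n j))"
    unfolding eq by (subst sum.reindex) (auto simp: inj_on_def intro!: sum.cong)
  also have "\<dots> = (\<Sum>n=1..N. f n i) * (\<Sum>ns\<in>?L. \<Prod>(n, j)\<leftarrow>zip ns s. f n j)"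
    by (simp add: sum_product sum.cartesian_product)
  also note Cons.IH
  finally show ?case by simp
qed

lemma norm_T_weight:
  "norm (T_weight a s ns) = (\<Prod>(n, j)\<leftarrow>zip ns s. norm (a n :: real) ^ j)"
proof -
  have "\<bar>\<Prod>(n, j)\<leftarrow>zs. a n ^ j\<bar> = (\<Prod>(n, j)\<leftarrow>zs. \<bar>a n\<bar> ^ j)" for zs
    by (induction zs) (auto simp: abs_mult power_abs)
  thus ?thesis by (simp add: T_weight_def abs_mult power_abs)
qed

text \<open>
  The absolute values are summable because any finite set of chains of length \<open>r\<close> lies in a cube
  \<open>{1..N} ^ r\<close>, over which the sum factors into at most \<open>(\<Sum>n. 1 / n\<^sup>2) ^ r\<close>.
\<close>

lemma T_weight_summable:
  assumes "\<And>j. j \<in> set s \<Longrightarrow> j \<ge> 1"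
  shows "T_weight (\<lambda>n. 1 / real n ^ 2) s summable_on T_index (length s)"
proof (rule abs_summable_summable, rule nonneg_bdd_above_summable_on)
  define K where "K = suminf (\<lambda>n. 1 / real n ^ 2)"
  have summable: "summable (\<lambda>n. 1 / real n ^ 2)"
    using inverse_power_summable[of 2, where ?'a = real] by (simp add: inverse_eq_divide)
  have le_K: "(\<Sum>n=1..N. (1 / real n ^ 2) ^ j) \<le> K" if "j \<ge> 1" for N j
  proof -
    have "(\<Sum>n=1..N. (1 / real n ^ 2) ^ j) \<le> (\<Sum>n=1..N. 1 / real n ^ 2)"
      using that by (intro sum_mono order.trans[OF power_decreasing[of 1 j]])
        (auto simp: divide_simps)
    also have "\<dots> \<le> K" unfolding K_def
      by (rule sum_le_suminf[OF summable]) auto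
    finally show ?thesis .
  qed
  have K_nonneg: "K \<ge> 0" unfolding K_def by (rule suminf_nonneg[OF summable]) simp
  have bound: "(\<Prod>j\<leftarrow>s. \<Sum>n=1..N. (1 / real n ^ 2) ^ j) \<le> K ^ length s" for N
    using assms
  proof (induction s)
    case (Cons j s)
    have "(\<Prod>j\<leftarrow>s. \<Sum>n=1..N. (1 / real n ^ 2) ^ j) \<ge> 0"
      by (intro prod_list_nonneg) (auto intro!: sum_nonneg)
    with Cons le_K[of j N] K_nonneg show ?case
      by (auto intro!: mult_mono sum_nonneg)
  qed simp
  show "bdd_above (sum (\<lambda>ns. norm (T_weight (\<lambda>n. 1 / real n ^ 2) s ns)) `
      {F. F \<subseteq> T_index (length s) \<and> finite F})"
  proof (rule bdd_aboveI2)
    fix F assume F: "F \<in> {F. F \<subseteq> T_index (length s) \<and> finite F}"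
    hence "finite (\<Union>ns\<in>F. set ns)" by auto
    then obtain N where N: "(\<Union>ns\<in>F. set ns) \<subseteq> {..N}"
      using finite_nat_iff_bounded_le by blast
    let ?L = "{ns. set ns \<subseteq> {1..N} \<and> length ns = length s}"
    have "F \<subseteq> ?L" using F N by (fastforce simp: T_index_def)
    moreover have "finite ?L" by (rule finite_lists_length_eq) simp
    ultimately have "(\<Sum>ns\<in>F. norm (T_weight (\<lambda>n. 1 / real n ^ 2) s ns)) \<le>
        (\<Sum>ns\<in>?L. norm (T_weight (\<lambda>n. 1 / real n ^ 2) s ns))"
      by (intro sum_mono2) auto
    also have "\<dots> = (\<Prod>j\<leftarrow>s. \<Sum>n=1..N. (1 / real n ^ 2) ^ j)"
      unfolding norm_T_weight using sum_lists_prod[of "\<lambda>n j. (1 / real n ^ 2) ^ j" s N] by simp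
    also have "\<dots> \<le> K ^ length s" by (rule bound)
    finally show "(\<Sum>ns\<in>F. norm (T_weight (\<lambda>n. 1 / real n ^ 2) s ns)) \<le> K ^ length s" .
  qed
qed simp

lemma T_eq_infsum_T_weight:
  "T (map (\<lambda>j. real (2 * j)) s) = infsum (T_weight (\<lambda>n. 1 / real n ^ 2) s) (T_index (length s))"
  unfolding T_def length_map
proof (rule infsum_cong)
  fix ns assume ns: "ns \<in> T_index (length s)"
  have "(\<Prod>(n, j)\<leftarrow>zip ns s. (1 / real n ^ 2) ^ j) =
      (\<Prod>i<length s. (1 / real (ns ! i) ^ 2) ^ (s ! i))"
    using ns by (subst prod.list_conv_set_nth)
      (auto simp: T_index_def atLeast0LessThan intro!: prod.cong)
  also have "\<dots> = 1 / (\<Prod>i<length s. real (ns ! i) powr (map (\<lambda>j. real (2 * j)) s ! i))"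
  proof -
    have "real (ns ! i) powr real (2 * (s ! i)) = (real (ns ! i) ^ 2) ^ (s ! i)"
      if "i < length s" for i
    proof -
      have "ns ! i \<in> set ns" using ns that by (auto simp: T_index_def)
      hence "real (ns ! i) > 0" using ns by (fastforce simp: T_index_def)
      thus ?thesis by (subst powr_realpow) (auto simp: power_mult)
    qed
    thus ?thesis by (simp add: power_one_over prod_dividef)
  qed
  finally show "(- 1) ^ sum_list ns /
      (\<Prod>i<length s. real (ns ! i) powr (map (\<lambda>j. real (2 * j)) s ! i)) =
      T_weight (\<lambda>n. 1 / real n ^ 2) s ns"
    by (simp add: T_weight_def)
qed

lemma T_upto_tendsto_T:
  assumes "\<And>j. j \<in> set s \<Longrightarrow> j \<ge> 1"
  shows "(\<lambda>N. T_upto (\<lambda>n. 1 / real n ^ 2) N s) \<longlonglongrightarrow> T (map (\<lambda>j. real (2 * j)) s)"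
proof -
  have "filterlim (\<lambda>N. T_index_upto N (length s)) (finite_subsets_at_top (T_index (length s))) sequentially"
    unfolding filterlim_finite_subsets_at_top
  proof safe
    fix F assume F: "finite F" "F \<subseteq> T_index (length s)"
    hence "finite (\<Union>ns\<in>F. set ns)" by auto
    then obtain M where M: "(\<Union>ns\<in>F. set ns) \<subseteq> {..M}"
      using finite_nat_iff_bounded_le by blast
    show "\<forall>\<^sub>F N in sequentially. finite (T_index_upto N (length s)) \<and>
        F \<subseteq> T_index_upto N (length s) \<and> T_index_upto N (length s) \<subseteq> T_index (length s)"
      using eventually_ge_at_top[of M]
    proof eventually_elim
      case (elim N)
      have "n \<le> N" if "ns \<in> F" "n \<in> set ns" for n ns
        using M that elim by fastforce
      hence "F \<subseteq> T_index_upto N (length s)" using F by (auto simp: T_index_upto_def)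
      thus ?case using finite_T_index_upto[of N "length s"] by (simp add: T_index_upto_def)
    qed
  qed
  moreover have "(sum (T_weight (\<lambda>n. 1 / real n ^ 2) s) \<longlongrightarrow> T (map (\<lambda>j. real (2 * j)) s))
      (finite_subsets_at_top (T_index (length s)))"
    unfolding T_eq_infsum_T_weight by (rule infsum_tendsto[OF T_weight_summable[OF assms]])
  ultimately show ?thesis
    unfolding T_upto_def by (rule filterlim_compose[rotated])
qed

text \<open>
  By homogeneity the factor \<open>4 / \<pi>\<^sup>2\<close> in \<open>a\<^sub>n\<close> comes out of the sums as a power.
\<close>

lemma T_upto_scale: "T_upto (\<lambda>n. c * a n) N s = c ^ sum_list s * T_upto a N s"
proof -
  have "T_weight (\<lambda>n. c * a n) s ns = c ^ sum_list s * T_weight a s ns"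
    if "length ns = length s" for ns
  proof -
    have "(\<Prod>(n, j)\<leftarrow>zip ns s. (c * a n) ^ j) = c ^ sum_list s * (\<Prod>(n, j)\<leftarrow>zip ns s. a n ^ j)"
      using that by (induction ns s rule: list_induct2) (auto simp: power_add power_mult_distrib mult_ac)
    thus ?thesis by (simp add: T_weight_def)
  qed
  thus ?thesis
    by (auto simp: T_upto_def sum_distrib_left T_index_upto_def T_index_def intro!: sum.cong)
qed

lemma T_upto_of_real:
  "T_upto (\<lambda>n. of_real (a n) :: complex) N s = of_real (T_upto a N s)"
proof -
  have "T_weight (\<lambda>n. of_real (a n) :: complex) s ns = of_real (T_weight a s ns)" for ns
  proof -
    have "(\<Prod>(n, j)\<leftarrow>zs. (of_real (a n) :: complex) ^ j) = of_real (\<Prod>(n, j)\<leftarrow>zs. a n ^ j)" for zs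
      by (induction zs) auto
    thus ?thesis by (simp add: T_weight_def)
  qed
  thus ?thesis by (simp add: T_upto_def)
qed

section \<open>The product expansion of sinh\<close>

text \<open>
  The series of \<open>sinh (sqrt z) / sqrt z\<close>, followed by the partial products of its Weierstrass product.
\<close>

definition sinhc_fps :: "real fps" where
  "sinhc_fps = Abs_fps (\<lambda>k. 1 / fact (2 * k + 1))"

definition sinhc_partial :: "nat \<Rightarrow> real fps" where
  "sinhc_partial N = (\<Prod>n=1..N. 1 + fps_const (1 / (pi * real n) ^ 2) * fps_X)"

lemma sinhc_partial_Suc_nth:
  "fps_nth (sinhc_partial (Suc N)) k = fps_nth (sinhc_partial N) k +
     (if k = 0 then 0 else 1 / (pi * real (Suc N)) ^ 2 * fps_nth (sinhc_partial N) (k - 1))"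
proof -
  have "sinhc_partial (Suc N) = sinhc_partial N +
      fps_const (1 / (pi * real (Suc N)) ^ 2) * (fps_X * sinhc_partial N)"
    by (simp add: sinhc_partial_def algebra_simps del: of_nat_Suc)
  thus ?thesis by (simp del: of_nat_Suc)
qed

lemma sinhc_partial_nonneg: "fps_nth (sinhc_partial N) k \<ge> 0"
proof (induction N arbitrary: k)
  case 0
  then show ?case by (simp add: sinhc_partial_def)
qed (simp add: sinhc_partial_Suc_nth)

lemma sinhc_partial_sums:
  fixes z :: "'a::{real_normed_field, banach}"
  shows "(\<lambda>k. of_real (fps_nth (sinhc_partial N) k) * z ^ k) sums
    (\<Prod>n=1..N. 1 + of_real (1 / (pi * real n) ^ 2) * z)"
proof (induction N)
  case 0
  have "(\<lambda>k. of_real (fps_nth (sinhc_partial 0) k) * z ^ k) = (\<lambda>k. if k = 0 then 1 else 0)"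
    by (auto simp: sinhc_partial_def fun_eq_iff)
  then show ?case using sums_single[of 0 "\<lambda>_. 1 :: 'a"] by simp
next
  case (Suc N)
  let ?c = "\<lambda>k. of_real (fps_nth (sinhc_partial N) k) * z ^ k"
  let ?P = "\<Prod>n=1..N. 1 + of_real (1 / (pi * real n) ^ 2) * z"
  define a :: 'a where "a = of_real (1 / (pi * real (Suc N)) ^ 2) * z"
  have "(\<lambda>k. if k = 0 then 0 else ?c (k - 1)) sums ?P"
    using sums_Suc[of "\<lambda>k. if k = 0 then 0 else ?c (k - 1)" ?P] Suc.IH by simp
  from sums_add[OF Suc.IH sums_mult[OF this, of a]]
  have "(\<lambda>k. ?c k + a * (if k = 0 then 0 else ?c (k - 1))) sums (?P + a * ?P)" .
  also have "(\<lambda>k. ?c k + a * (if k = 0 then 0 else ?c (k - 1))) =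
      (\<lambda>k. of_real (fps_nth (sinhc_partial (Suc N)) k) * z ^ k)"
  proof
    fix k
    show "?c k + a * (if k = 0 then 0 else ?c (k - 1)) =
        of_real (fps_nth (sinhc_partial (Suc N)) k) * z ^ k"
      unfolding sinhc_partial_Suc_nth a_def
      by (cases k) (simp_all add: algebra_simps del: of_nat_Suc)
  qed
  also have "?P + a * ?P = (\<Prod>n=1..Suc N. 1 + of_real (1 / (pi * real n) ^ 2) * z)"
    by (simp add: a_def algebra_simps del: of_nat_Suc)
  finally show ?case .
qed

text \<open>
  Both the series and the product are those of \<open>sin u / u\<close> at \<open>u = sqrt (-z)\<close>.
\<close>

lemma sinhc_product:
  fixes z :: complex
  shows "(\<lambda>k. of_real (fps_nth sinhc_fps k) * z ^ k) sums
      (if z = 0 then 1 else sin (csqrt (-z)) / csqrt (-z))" (is ?th1)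
    and "(\<lambda>N. \<Prod>n=1..N. 1 + of_real (1 / (pi * real n) ^ 2) * z) \<longlonglongrightarrow>
      (if z = 0 then 1 else sin (csqrt (-z)) / csqrt (-z))" (is ?th2)
proof -
  define u where "u = csqrt (-z)"
  have u2: "u ^ 2 = - z" by (simp add: u_def)
  show ?th1
  proof (cases "z = 0")
    case True
    have "(\<lambda>k. of_real (fps_nth sinhc_fps k) * z ^ k) = (\<lambda>k. if k = 0 then 1 else 0)"
      using True by (auto simp: sinhc_fps_def fun_eq_iff)
    then show ?thesis using True sums_single[of 0 "\<lambda>_. 1 :: complex"] by simp
  next
    case False
    hence "u \<noteq> 0" by (auto simp: u_def)
    have "(\<lambda>n. \<Sum>k = n * 2..<n * 2 + 2. sin_coeff k *\<^sub>R u ^ k) sums sin u"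
      by (rule sums_group[OF sin_converges]) simp
    also have "(\<lambda>n. \<Sum>k = n * 2..<n * 2 + 2. sin_coeff k *\<^sub>R u ^ k) =
        (\<lambda>n. (- 1) ^ n / fact (2 * n + 1) * u ^ (2 * n + 1))"
      by (auto simp: sin_coeff_def scaleR_conv_of_real mult.commute[of _ 2] fun_eq_iff)
    finally have "(\<lambda>n. (- 1) ^ n / fact (2 * n + 1) * u ^ (2 * n + 1) / u) sums (sin u / u)"
      by (rule sums_divide)
    also have "(\<lambda>n. (- 1) ^ n / fact (2 * n + 1) * u ^ (2 * n + 1) / u) =
        (\<lambda>k. of_real (fps_nth sinhc_fps k) * z ^ k)"
    proof
      fix n
      have "u ^ (2 * n + 1) / u = (u ^ 2) ^ n"
        using \<open>u \<noteq> 0\<close> by (simp add: power_mult)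
      also have "\<dots> = (-1) ^ n * z ^ n"
        unfolding u2 by (rule power_minus)
      finally have "(- 1) ^ n / fact (2 * n + 1) * (u ^ (2 * n + 1) / u) =
          (- 1) ^ n / fact (2 * n + 1) * ((-1) ^ n * z ^ n)" by simp
      also have "\<dots> = of_real (fps_nth sinhc_fps n) * z ^ n"
        by (simp add: sinhc_fps_def flip: power_mult_distrib)
      finally show "(- 1) ^ n / fact (2 * n + 1) * u ^ (2 * n + 1) / u = of_real (fps_nth sinhc_fps n) * z ^ n"
        by (simp only: times_divide_eq_right)
    qed
    finally show ?thesis using False by (simp add: u_def)
  qed
  show ?th2
  proof (cases "z = 0")
    case False
    hence "u \<noteq> 0" by (auto simp: u_def)
    define w where "w = u / of_real pi"
    have w: "of_real pi * w = u" by (simp add: w_def)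
    have "(\<lambda>N. (of_real pi * w * (\<Prod>n=1..N. 1 - w ^ 2 / of_nat n ^ 2)) / u) \<longlonglongrightarrow> sin (of_real pi * w) / u"
      by (intro tendsto_divide sin_product_formula_complex tendsto_const \<open>u \<noteq> 0\<close>)
    also have "(\<lambda>N. (of_real pi * w * (\<Prod>n=1..N. 1 - w ^ 2 / of_nat n ^ 2)) / u) =
        (\<lambda>N. \<Prod>n=1..N. 1 + of_real (1 / (pi * real n) ^ 2) * z)"
    proof
      fix N
      have "(\<Prod>n=1..N. 1 - w ^ 2 / of_nat n ^ 2) = (\<Prod>n=1..N. 1 + of_real (1 / (pi * real n) ^ 2) * z)"
        by (intro prod.cong refl) (simp add: w_def power_divide power_mult_distrib u2)
      thus "(of_real pi * w * (\<Prod>n=1..N. 1 - w ^ 2 / of_nat n ^ 2)) / u =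
        (\<Prod>n=1..N. 1 + of_real (1 / (pi * real n) ^ 2) * z)"
        using \<open>u \<noteq> 0\<close> w by simp
    qed
    finally show ?thesis using False w by (simp add: u_def)
  qed simp
qed

text \<open>
  Each coefficient of the partial products increases with \<open>N\<close> and is bounded by the value of the
  partial product at \<open>1\<close>, hence converges. Tannery's theorem identifies the power series of the
  limits, on the unit disc, with the limit of the partial products; comparing coefficients shows that
  the limits are the right ones.
\<close>

lemma sinhc_partial_tendsto:
  "(\<lambda>N. fps_nth (sinhc_partial N) k) \<longlonglongrightarrow> fps_nth sinhc_fps k"
proof -
  let ?c = "\<lambda>N k. fps_nth (sinhc_partial N) k"
  have mono: "incseq (\<lambda>N. ?c N k)" for k
    by (rule incseq_SucI) (simp add: sinhc_partial_Suc_nth sinhc_partial_nonneg)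
  have "convergent (\<lambda>N. \<Prod>n=1..N. 1 + of_real (1 / (pi * real n) ^ 2) * (1 :: complex))"
    using sinhc_product(2)[of 1] by (auto simp: convergent_def)
  then obtain M where M: "norm (\<Prod>n=1..N. 1 + of_real (1 / (pi * real n) ^ 2) * (1 :: complex)) \<le> M" for N
    using convergent_imp_Bseq BseqE by (metis (no_types, lifting))
  have c_le: "?c N k \<le> M" for N k
  proof -
    have s: "?c N sums (\<Prod>n=1..N. 1 + of_real (1 / (pi * real n) ^ 2) * (1 :: real))"
      using sinhc_partial_sums[of N "1 :: real"] by simp
    have "(\<Sum>i\<in>{k}. ?c N i) \<le> suminf (?c N)"
      using s by (intro sum_le_suminf) (auto simp: sums_iff sinhc_partial_nonneg)
    also have "\<dots> = (\<Prod>n=1..N. 1 + of_real (1 / (pi * real n) ^ 2) * (1 :: real))"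
      using s by (simp add: sums_iff)
    also have "\<dots> = norm (of_real (\<Prod>n=1..N. 1 + of_real (1 / (pi * real n) ^ 2) * (1 :: real)) :: complex)"
      unfolding norm_of_real by (rule abs_of_nonneg[symmetric], rule prod_nonneg) auto
    also have "\<dots> \<le> M" using M[of N] by simp
    finally show ?thesis by simp
  qed
  obtain d where d: "(\<lambda>N. ?c N k) \<longlonglongrightarrow> d k" for k
  proof -
    have "\<exists>l. (\<lambda>N. ?c N k) \<longlonglongrightarrow> l" for k
      using incseq_convergent[OF mono, of k M] c_le by blast
    thus ?thesis using that by metis
  qed
  define f g :: "complex fps" where "f = Abs_fps (\<lambda>k. of_real (d k))"
    and "g = Abs_fps (\<lambda>k. of_real (fps_nth sinhc_fps k))"
  have key: "summable (\<lambda>k. of_real (d k) * z ^ k)"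
      "suminf (\<lambda>k. of_real (d k) * z ^ k) = suminf (\<lambda>k. of_real (fps_nth sinhc_fps k) * z ^ k)"
    if "norm z < 1" for z :: complex
  proof -
    have "norm (complex_of_real (?c N k) * z ^ k) \<le> M * norm z ^ k" for N k
      using c_le[of N k] sinhc_partial_nonneg[of N k]
      by (auto simp: norm_mult norm_power intro!: mult_right_mono)
    moreover have "summable (\<lambda>k. M * norm z ^ k)"
      using that by (intro summable_mult summable_geometric) auto
    moreover have "(\<lambda>N. complex_of_real (?c N k) * z ^ k) \<longlonglongrightarrow> of_real (d k) * z ^ k" for k
      by (intro tendsto_intros d)
    ultimately have *: "summable (\<lambda>k. norm (of_real (d k) * z ^ k)) \<and>
        (\<lambda>N. suminf (\<lambda>k. of_real (?c N k) * z ^ k)) \<longlonglongrightarrow> suminf (\<lambda>k. of_real (d k) * z ^ k)"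
      using tannerys_theorem[of "\<lambda>k N. complex_of_real (?c N k) * z ^ k" "\<lambda>k. of_real (d k) * z ^ k"
          sequentially "\<lambda>k. M * norm z ^ k"]
      by (simp add: case_prod_unfold)
    show "summable (\<lambda>k. of_real (d k) * z ^ k)"
      by (rule summable_norm_cancel[OF conjunct1[OF *]])
    have "(\<lambda>N. suminf (\<lambda>k. of_real (?c N k) * z ^ k)) \<longlonglongrightarrow> (if z = 0 then 1 else sin (csqrt (-z)) / csqrt (-z))"
      using sinhc_product(2)[of z] sinhc_partial_sums[of _ z] by (simp add: sums_iff)
    moreover have "(\<lambda>N. suminf (\<lambda>k. of_real (?c N k) * z ^ k)) \<longlonglongrightarrow> suminf (\<lambda>k. of_real (d k) * z ^ k)"
      using * by (rule conjunct2)
    ultimately have "suminf (\<lambda>k. of_real (d k) * z ^ k) = (if z = 0 then 1 else sin (csqrt (-z)) / csqrt (-z))"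
      by (rule LIMSEQ_unique[rotated])
    also have "\<dots> = suminf (\<lambda>k. of_real (fps_nth sinhc_fps k) * z ^ k)"
      by (rule sums_unique[OF sinhc_product(1)])
    finally show "suminf (\<lambda>k. of_real (d k) * z ^ k) = suminf (\<lambda>k. of_real (fps_nth sinhc_fps k) * z ^ k)" .
  qed
  have "f = g"
  proof (rule eval_fps_eqD)
    have "summable (\<lambda>k. of_real (d k) * (1 / 2 :: complex) ^ k)" by (rule key) (simp add: norm_divide)
    hence "fps_conv_radius f \<ge> norm (1 / 2 :: complex)"
      unfolding fps_conv_radius_def f_def by (intro conv_radius_geI) simp
    thus "fps_conv_radius f > 0" by (rule less_le_trans[rotated]) simp
    have "summable (\<lambda>k. of_real (fps_nth sinhc_fps k) * (1 / 2 :: complex) ^ k)"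
      using sinhc_product(1) by (rule sums_summable)
    hence "fps_conv_radius g \<ge> norm (1 / 2 :: complex)"
      unfolding fps_conv_radius_def g_def by (intro conv_radius_geI) simp
    thus "fps_conv_radius g > 0" by (rule less_le_trans[rotated]) simp
    have "eventually (\<lambda>z :: complex. z \<in> ball 0 1) (nhds 0)"
      by (rule eventually_nhds_in_open) auto
    thus "eventually (\<lambda>z. eval_fps f z = eval_fps g z) (nhds 0)"
      by eventually_elim (use key(2) in \<open>simp add: eval_fps_def f_def g_def\<close>)
  qed
  hence "fps_nth f k = fps_nth g k" by simp
  hence "d k = fps_nth sinhc_fps k" by (simp add: f_def g_def)
  with d[of k] show ?thesis by simp
qed

section \<open>The expansion of the product of the series Q\<close>

lemma tendsto_fps_mult_nth:
  fixes f g :: "'a::real_normed_field fps"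
  assumes "\<And>k. (\<lambda>N. fps_nth (F N) k) \<longlonglongrightarrow> fps_nth f k" "\<And>k. (\<lambda>N. fps_nth (G N) k) \<longlonglongrightarrow> fps_nth g k"
  shows "(\<lambda>N. fps_nth (F N * G N) k) \<longlonglongrightarrow> fps_nth (f * g) k"
  unfolding fps_mult_nth by (intro tendsto_intros assms)

lemma tendsto_fps_prod_nth:
  fixes f :: "'i \<Rightarrow> 'a::real_normed_field fps"
  assumes "\<And>i k. i \<in> I \<Longrightarrow> (\<lambda>N. fps_nth (F N i) k) \<longlonglongrightarrow> fps_nth (f i) k"
  shows "(\<lambda>N. fps_nth (\<Prod>i\<in>I. F N i) k) \<longlonglongrightarrow> fps_nth (\<Prod>i\<in>I. f i) k"
  using assms
  by (induction I arbitrary: k rule: infinite_finite_induct) (auto intro!: tendsto_fps_mult_nth)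

text \<open>
  The substitution \<open>f(x t)\<close> for complex \<open>x\<close>.
\<close>

definition scale_fps :: "complex \<Rightarrow> real fps \<Rightarrow> complex fps" where
  "scale_fps x f = Abs_fps (\<lambda>n. of_real (fps_nth f n) * x ^ n)"

lemma scale_fps_1 [simp]: "scale_fps x 1 = 1"
  by (rule fps_ext) (simp add: scale_fps_def)

lemma scale_fps_mult: "scale_fps x (f * g) = scale_fps x f * scale_fps x g"
proof (rule fps_ext)
  fix n
  have "fps_nth (scale_fps x (f * g)) n =
      (\<Sum>i=0..n. of_real (fps_nth f i) * of_real (fps_nth g (n - i)) * x ^ n)"
    by (simp add: scale_fps_def fps_mult_nth sum_distrib_right)
  also have "\<dots> = fps_nth (scale_fps x f * scale_fps x g) n"
    unfolding fps_mult_nth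
  proof (intro sum.cong refl)
    fix i assume "i \<in> {0..n}"
    hence "x ^ n = x ^ i * x ^ (n - i)" by (simp flip: power_add)
    thus "of_real (fps_nth f i) * of_real (fps_nth g (n - i)) * x ^ n =
        fps_nth (scale_fps x f) i * fps_nth (scale_fps x g) (n - i)"
      by (simp add: scale_fps_def)
  qed
  finally show "fps_nth (scale_fps x (f * g)) n = fps_nth (scale_fps x f * scale_fps x g) n" .
qed

lemma scale_fps_linear:
  "scale_fps x (1 + fps_const c * fps_X) = 1 + fps_const (of_real c * x) * fps_X"
proof (rule fps_ext)
  fix n
  show "fps_nth (scale_fps x (1 + fps_const c * fps_X)) n =
      fps_nth (1 + fps_const (of_real c * x) * fps_X) n"
    by (cases "n = 0 \<or> n = 1") (auto simp: scale_fps_def fps_X_def)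
qed

text \<open>
  The finite form of \<open>\<Prod>i. Q(x\<^sub>i t) S(x\<^sub>i t)\<^sup>2 = \<Prod>i. S(4 x\<^sub>i t)\<close>. Raising \<open>N\<close> by one multiplies the product
  of the \<open>S(x\<^sub>i t)\<close> by \<open>E(a\<^bsub>2 N + 2\<^esub>)\<close>, because \<open>a\<^bsub>2 n\<^esub> = 1 / (\<pi> n)\<^sup>2\<close>, and the product of the \<open>S(4 x\<^sub>i t)\<close>
  by \<open>E(a\<^bsub>2 N + 1\<^esub>) E(a\<^bsub>2 N + 2\<^esub>)\<close>; the series on the left changes by \<open>E(a\<^bsub>2 N + 1\<^esub>) / E(a\<^bsub>2 N + 2\<^esub>)\<close>.
\<close>

lemma T_series_mult_sinhc_partial:
  fixes x :: "nat \<Rightarrow> complex"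
  defines "a \<equiv> \<lambda>n. complex_of_real (4 / pi ^ 2 * (1 / real n ^ 2))"
  shows "T_series (esym_eval m x) a (2 * N) *
      (\<Prod>i=1..m. scale_fps (x i) (sinhc_partial N) * scale_fps (x i) (sinhc_partial N)) =
      (\<Prod>i=1..m. scale_fps (4 * x i) (sinhc_partial (2 * N)))"
proof (induction N)
  case 0
  show ?case by (simp add: T_series_0 sinhc_partial_def)
next
  case (Suc N)
  define E where "E n = e_series (esym_eval m x) (a n)" for n
  define S where "S N = (\<Prod>i=1..m. scale_fps (x i) (sinhc_partial N))" for N
  define S4 where "S4 N = (\<Prod>i=1..m. scale_fps (4 * x i) (sinhc_partial N))" for N
  let ?W = "T_series (esym_eval m x) a"
  have S4_Suc: "S4 (Suc n) = S4 n * E (Suc n)" for n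
  proof -
    have "of_real (1 / (pi * real (Suc n)) ^ 2) * (4 * x i) = a (Suc n) * x i" for i
      by (simp add: a_def power_mult_distrib del: of_nat_Suc)
    thus ?thesis
      by (simp add: S4_def E_def sinhc_partial_def scale_fps_mult scale_fps_linear prod.distrib
          prod_linear_eq_esym[symmetric] del: of_nat_Suc)
  qed
  have S_Suc: "S (Suc n) = S n * E (2 * n + 2)" for n
  proof -
    have "of_real (1 / (pi * real (Suc n)) ^ 2) * x i = a (2 * n + 2) * x i" for i
    proof -
      have "real (2 * n + 2) = 2 * real (Suc n)" by simp
      hence "4 / pi ^ 2 * (1 / real (2 * n + 2) ^ 2) = 1 / (pi * real (Suc n)) ^ 2"
        by (simp only: power_mult_distrib) simp
      thus ?thesis unfolding a_def by (simp only:)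
    qed
    thus ?thesis
      by (simp add: S_def E_def sinhc_partial_def scale_fps_mult scale_fps_linear prod.distrib
          prod_linear_eq_esym[symmetric] del: of_nat_Suc)
  qed
  have IH: "?W (2 * N) * (S N * S N) = S4 (2 * N)"
    using Suc.IH by (simp add: S_def S4_def prod.distrib)
  have "?W (2 * Suc N) * (S (Suc N) * S (Suc N)) =
      (?W (2 * Suc N) * E (2 * N + 2)) * E (2 * N + 2) * (S N * S N)"
    by (simp add: S_Suc mult_ac)
  also have "?W (2 * Suc N) * E (2 * N + 2) = ?W (2 * N) * E (2 * N + 1)"
    unfolding E_def by (rule T_series_step)
  also have "\<dots> * E (2 * N + 2) * (S N * S N) = S4 (2 * N) * E (2 * N + 1) * E (2 * N + 2)"
    unfolding IH[symmetric] by (simp only: mult_ac)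
  also have "\<dots> = S4 (2 * Suc N)"
    by (simp add: S4_Suc)
  finally show ?case by (simp add: S_def S4_def prod.distrib)
qed

definition hirzebruch_Q_real :: "real fps" where
  "hirzebruch_Q_real = Abs_fps (\<lambda>n. of_rat (fps_nth hirzebruch_Q n))"

lemma sum_odd_choose_even: "(\<Sum>j\<le>n. real ((2 * n + 1) choose (2 * j))) = 4 ^ n"
proof -
  have "2 * (\<Sum>i\<le>2 * n + 1. if even i then real ((2 * n + 1) choose i) else 0) = 2 ^ (2 * n + 1)"
    using choose_even_sum[of "2 * n + 1", where ?'a = real] by simp
  moreover have "(\<Sum>i\<le>2 * n + 1. if even i then real ((2 * n + 1) choose i) else 0) =
      (\<Sum>i\<in>(\<lambda>j. 2 * j) ` {..n}. real ((2 * n + 1) choose i))"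
  proof (rule sum.mono_neutral_cong_right)
    show "\<forall>i\<in>{..2 * n + 1} - (\<lambda>j. 2 * j) ` {..n}. (if even i then real ((2 * n + 1) choose i) else 0) = 0"
      by (auto elim!: evenE)
  qed auto
  moreover have "\<dots> = (\<Sum>j\<le>n. real ((2 * n + 1) choose (2 * j)))"
    by (subst sum.reindex) (auto simp: inj_on_def)
  ultimately show ?thesis by (simp add: power_mult)
qed

lemma of_rat_fact: "of_rat (fact n) = (fact n :: 'a::field_char_0)"
  by (metis of_nat_fact of_rat_of_nat_eq)

text \<open>
  \<open>Q(z) S(z) = cosh (sqrt z)\<close> by definition, and multiplying by \<open>S(z)\<close> once more gives \<open>S(4 z)\<close> by the
  duplication formula of \<open>sinh\<close>, in the guise of a sum of binomial coefficients.
\<close>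

lemma hirzebruch_Q_real_mult_sinhc:
  "hirzebruch_Q_real * (sinhc_fps * sinhc_fps) = Abs_fps (\<lambda>k. 4 ^ k * fps_nth sinhc_fps k)"
proof -
  define C :: "real fps" where "C = Abs_fps (\<lambda>n. 1 / fact (2 * n))"
  have rat: "hirzebruch_Q * Abs_fps (\<lambda>n. 1 / fact (2 * n + 1)) = Abs_fps (\<lambda>n. 1 / fact (2 * n))"
    unfolding hirzebruch_Q_def by (simp add: fps_divide_unit mult.assoc inverse_mult_eq_1)
  have "hirzebruch_Q_real * sinhc_fps = C"
  proof (rule fps_ext)
    fix n
    have "fps_nth (hirzebruch_Q_real * sinhc_fps) n =
        of_rat (fps_nth (hirzebruch_Q * Abs_fps (\<lambda>n. 1 / fact (2 * n + 1))) n)"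
      by (simp add: fps_mult_nth hirzebruch_Q_real_def sinhc_fps_def of_rat_sum of_rat_mult
          of_rat_divide of_rat_fact del: fact_Suc)
    also have "\<dots> = fps_nth C n"
      unfolding rat by (simp add: C_def of_rat_divide of_rat_fact)
    finally show "fps_nth (hirzebruch_Q_real * sinhc_fps) n = fps_nth C n" .
  qed
  moreover have "C * sinhc_fps = Abs_fps (\<lambda>k. 4 ^ k * fps_nth sinhc_fps k)"
  proof (rule fps_ext)
    fix n
    have "fps_nth (C * sinhc_fps) n = (\<Sum>j\<le>n. real ((2 * n + 1) choose (2 * j)) / fact (2 * n + 1))"
      unfolding fps_mult_nth atLeast0AtMost
    proof (intro sum.cong refl)
      fix j assume "j \<in> {..n}"
      hence "2 * j \<le> 2 * n + 1" "2 * n + 1 - 2 * j = 2 * (n - j) + 1" by auto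
      thus "fps_nth C j * fps_nth sinhc_fps (n - j) = real ((2 * n + 1) choose (2 * j)) / fact (2 * n + 1)"
        by (simp add: C_def sinhc_fps_def binomial_fact del: fact_Suc)
    qed
    thus "fps_nth (C * sinhc_fps) n = fps_nth (Abs_fps (\<lambda>k. 4 ^ k * fps_nth sinhc_fps k)) n"
      using sum_odd_choose_even[of n] by (simp add: sinhc_fps_def flip: sum_divide_distrib)
  qed
  ultimately show ?thesis by (simp add: mult.assoc[symmetric])
qed

text \<open>
  In the limit \<open>N \<rightarrow> \<infinity>\<close> the generating series \<open>W\<close> of the sums \<open>T\<close> and \<open>\<Prod>i. Q(x\<^sub>i t)\<close> satisfy the same
  equation: multiplied by \<open>\<Prod>i. S(x\<^sub>i t)\<^sup>2\<close> they give \<open>\<Prod>i. S(4 x\<^sub>i t)\<close>. As \<open>S\<close> has constant term \<open>1\<close>, it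
  can be cancelled.
\<close>

lemma sum_compositions_T_eq_hirzebruch_part:
  fixes x :: "nat \<Rightarrow> complex"
  shows "(\<Sum>s\<in>compositions k. (-1) ^ length s * (\<Prod>j\<leftarrow>s. esym_eval m x j) *
      of_real ((4 / pi ^ 2) ^ k * T (map (\<lambda>j. real (2 * j)) s))) =
    mpoly_eval x (hirzebruch_part m k)"
proof -
  define a where "a = (\<lambda>n. complex_of_real (4 / pi ^ 2 * (1 / real n ^ 2)))"
  define W where "W = Abs_fps (\<lambda>k. \<Sum>s\<in>compositions k. (-1) ^ length s * (\<Prod>j\<leftarrow>s. esym_eval m x j) *
      complex_of_real ((4 / pi ^ 2) ^ k * T (map (\<lambda>j. real (2 * j)) s)))"
  define S S4 where "S = (\<Prod>i=1..m. scale_fps (x i) sinhc_fps * scale_fps (x i) sinhc_fps)"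
    and "S4 = (\<Prod>i=1..m. scale_fps (4 * x i) sinhc_fps)"
  have double: "filterlim (\<lambda>N :: nat. 2 * N) sequentially sequentially"
    by (rule filterlim_subseq) (auto simp: strict_mono_def)
  have T_upto: "(\<lambda>N. T_upto a N s) \<longlonglongrightarrow> of_real ((4 / pi ^ 2) ^ k * T (map (\<lambda>j. real (2 * j)) s))"
    if "s \<in> compositions k" for s k
  proof -
    have "T_upto a N s = of_real ((4 / pi ^ 2) ^ k * T_upto (\<lambda>n. 1 / real n ^ 2) N s)" for N
      using that unfolding a_def T_upto_of_real T_upto_scale by (simp add: compositions_def)
    moreover have "(\<lambda>N. T_upto (\<lambda>n. 1 / real n ^ 2) N s) \<longlonglongrightarrow> T (map (\<lambda>j. real (2 * j)) s)"
      using that by (intro T_upto_tendsto_T) (auto simp: compositions_def)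
    ultimately show ?thesis by (auto intro!: tendsto_intros)
  qed
  have "(\<lambda>N. fps_nth (T_series (esym_eval m x) a N) k) \<longlonglongrightarrow> fps_nth W k" for k
    unfolding T_series_def W_def fps_nth_Abs_fps by (intro tendsto_intros T_upto)
  hence W_lim: "(\<lambda>N. fps_nth (T_series (esym_eval m x) a (2 * N)) k) \<longlonglongrightarrow> fps_nth W k" for k
    using double by (rule filterlim_compose)
  have scale_lim: "(\<lambda>N. fps_nth (scale_fps y (sinhc_partial N)) k) \<longlonglongrightarrow> fps_nth (scale_fps y sinhc_fps) k" for y k
    unfolding scale_fps_def fps_nth_Abs_fps by (intro tendsto_intros sinhc_partial_tendsto)
  have "W * S = S4"
  proof (rule fps_ext)
    fix k
    have "(\<lambda>N. fps_nth (T_series (esym_eval m x) a (2 * N) *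
        (\<Prod>i=1..m. scale_fps (x i) (sinhc_partial N) * scale_fps (x i) (sinhc_partial N))) k)
        \<longlonglongrightarrow> fps_nth (W * S) k"
      unfolding S_def
      by (rule tendsto_fps_mult_nth[OF W_lim tendsto_fps_prod_nth])
        (rule tendsto_fps_mult_nth[OF scale_lim scale_lim])
    moreover have "(\<lambda>N. fps_nth (\<Prod>i=1..m. scale_fps (4 * x i) (sinhc_partial (2 * N))) k) \<longlonglongrightarrow> fps_nth S4 k"
      unfolding S4_def by (rule tendsto_fps_prod_nth) (rule filterlim_compose[OF scale_lim double])
    ultimately show "fps_nth (W * S) k = fps_nth S4 k"
      unfolding a_def T_series_mult_sinhc_partial by (rule LIMSEQ_unique)
  qed
  moreover have "(\<Prod>i=1..m. scale_fps (x i) hirzebruch_Q_real) * S = S4"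
  proof -
    have "scale_fps y hirzebruch_Q_real * (scale_fps y sinhc_fps * scale_fps y sinhc_fps) =
        scale_fps (4 * y) sinhc_fps" for y
      unfolding scale_fps_mult[symmetric] hirzebruch_Q_real_mult_sinhc
      by (rule fps_ext) (simp add: scale_fps_def power_mult_distrib mult_ac)
    thus ?thesis by (simp add: S_def S4_def flip: prod.distrib)
  qed
  moreover have "S \<noteq> 0"
  proof
    assume "S = 0"
    hence "\<exists>i\<in>{1..m}. scale_fps (x i) sinhc_fps = 0" by (auto simp: S_def)
    then obtain i where "fps_nth (scale_fps (x i) sinhc_fps) 0 = 0"
      by (metis fps_zero_nth)
    thus False by (simp add: scale_fps_def sinhc_fps_def)
  qed
  ultimately have "W = (\<Prod>i=1..m. scale_fps (x i) hirzebruch_Q_real)"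
    by (metis mult_right_cancel)
  moreover have "scale_fps y hirzebruch_Q_real = Abs_fps (\<lambda>n. of_rat (fps_nth hirzebruch_Q n) * y ^ n)" for y
  proof -
    have "complex_of_real (of_rat q) = of_rat q" for q
      by (cases q) (simp add: of_rat_rat)
    thus ?thesis by (simp add: scale_fps_def hirzebruch_Q_real_def)
  qed
  ultimately have "fps_nth W k = mpoly_eval x (hirzebruch_part m k)"
    by (simp add: mpoly_eval_hirzebruch_part)
  thus ?thesis by (simp add: W_def)
qed

section \<open>Collecting words into monomials\<close>

definition monom_of :: "nat list \<Rightarrow> monom" where
  "monom_of s = (\<Sum>j\<leftarrow>s. Poly_Mapping.single j 1)"

lemma lookup_monom_of: "Poly_Mapping.lookup (monom_of s) j = count_list s j"
  by (induction s) (auto simp: monom_of_def lookup_add lookup_single when_def)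

lemma keys_monom_of: "Poly_Mapping.keys (monom_of s) = set s"
  by (auto simp: in_keys_iff lookup_monom_of count_list_0_iff)

lemma monom_of_eq_iff: "monom_of s = monom_of t \<longleftrightarrow> mset s = mset t"
  by (simp add: poly_mapping_eq_iff fun_eq_iff lookup_monom_of multiset_eq_iff count_mset)

lemma monom_eval_monom_of: "monom_eval p (monom_of s) = (\<Prod>j\<leftarrow>s. p j)"
  by (induction s) (auto simp: monom_of_def monom_eval_add)

definition L_coeff :: "nat \<Rightarrow> monom \<Rightarrow> real" where
  "L_coeff k J = (\<Sum>s | s \<in> compositions k \<and> monom_of s = J.
     (-1) ^ length s * ((4 / pi ^ 2) ^ k * T (map (\<lambda>j. real (2 * j)) s)))"

lemma L_coeff_sum_eq:
  fixes x :: "nat \<Rightarrow> complex"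
  shows "(\<Sum>J\<in>monom_of ` compositions k. of_real (L_coeff k J) * monom_eval (esym_eval m x) J) =
    mpoly_eval x (hirzebruch_part m k)"
proof -
  let ?f = "\<lambda>s. (-1) ^ length s * (\<Prod>j\<leftarrow>s. esym_eval m x j) *
      of_real ((4 / pi ^ 2) ^ k * T (map (\<lambda>j. real (2 * j)) s))"
  have "(\<Sum>J\<in>monom_of ` compositions k. of_real (L_coeff k J) * monom_eval (esym_eval m x) J) =
      (\<Sum>J\<in>monom_of ` compositions k. \<Sum>s | s \<in> compositions k \<and> monom_of s = J. ?f s)"
    unfolding L_coeff_def of_real_sum sum_distrib_right
    by (intro sum.cong refl) (auto simp: monom_eval_monom_of)
  also have "\<dots> = (\<Sum>s\<in>compositions k. ?f s)"
    by (rule sum.group) auto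
  finally show ?thesis by (simp only: sum_compositions_T_eq_hirzebruch_part)
qed

section \<open>The coefficients are determined\<close>

text \<open>
  Take for \<open>x\<close> the negated roots of \<open>t ^ k + p\<^sub>1 t ^ (k - 1) + \<cdots> + p\<^sub>k\<close>.
\<close>

lemma exists_esym_eval_eq:
  fixes p :: "nat \<Rightarrow> complex"
  shows "\<exists>x. \<forall>j\<in>{1..k}. esym_eval k x j = p j"
proof -
  define P where "P = monom 1 k + (\<Sum>j=1..k. monom (p j) (k - j))"
  have coeff_P: "coeff P (k - j) = p j" if "j \<in> {1..k}" for j
  proof -
    have "coeff P (k - j) = (\<Sum>i=1..k. if k - i = k - j then p i else 0)"
      using that by (auto simp: P_def coeff_sum)
    also have "\<dots> = (\<Sum>i=1..k. if i = j then p i else 0)"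
      using that by (intro sum.cong refl) auto
    finally have "coeff P (k - j) = (\<Sum>i=1..k. if i = j then p i else 0)" .
    with that show ?thesis by simp
  qed
  have coeff_k: "coeff P k = 1"
    unfolding P_def coeff_add coeff_sum coeff_monom by (auto intro!: sum.neutral)
  have deg: "degree P = k"
  proof (rule antisym)
    show "degree P \<le> k"
      unfolding P_def by (intro degree_add_le degree_sum_le) (auto intro: order.trans[OF degree_monom_le])
    show "k \<le> degree P" using coeff_k by (intro le_degree) simp
  qed
  obtain r where r: "P = (\<Prod>i<k. [:- r i, 1:])"
    using complex_poly_decompose'[of P] deg coeff_k by (metis smult_1_left)
  define x where "x i = - r (i - 1)" for i
  have "esym_eval k x j = p j" if j: "j \<in> {1..k}" for j
  proof -
    \<comment> \<open>Reversing the coefficients turns the factorization into the generating series of the \<open>e\<^sub>j\<close>.\<close>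
    have "reflect_poly P = (\<Prod>i<k. [:1, - r i:])"
      unfolding r reflect_poly_prod by (intro prod.cong refl) (simp add: reflect_poly_def)
    hence "fps_of_poly (reflect_poly P) = (\<Prod>i<k. fps_of_poly [:1, - r i:])"
      by (simp add: fps_of_poly_prod)
    also have "\<dots> = (\<Prod>i<k. 1 + fps_const (1 * x (Suc i)) * fps_X)"
      by (intro prod.cong refl) (simp add: x_def fps_of_poly_pCons)
    also have "\<dots> = (\<Prod>i=1..k. 1 + fps_const (1 * x i) * fps_X)"
      by (rule prod.reindex_bij_witness[of _ "\<lambda>i. i - 1" Suc]) auto
    finally have "coeff (reflect_poly P) j = fps_nth (e_series (esym_eval k x) 1) j"
      unfolding prod_linear_eq_esym by (metis fps_of_poly_nth)
    with j show ?thesis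
      by (simp add: coeff_reflect_poly deg coeff_P e_series_def)
  qed
  thus ?thesis by blast
qed

lemma monom_eval_cong:
  "(\<And>i. i \<in> Poly_Mapping.keys a \<Longrightarrow> x i = y i) \<Longrightarrow> monom_eval x a = monom_eval y a"
  by (simp add: monom_eval_def)

lemma set_composition: "s \<in> compositions k \<Longrightarrow> set s \<subseteq> {1..k}"
  using member_le_sum_list by (fastforce simp: compositions_def)

text \<open>
  Evaluating the defining equation for \<open>m = k\<close> at a complex point \<open>x\<close> shows that \<open>L\<close> and the
  polynomial with coefficients \<open>L_coeff k J\<close> agree at \<open>(e\<^sub>1(x), \<dots>, e\<^sub>k(x))\<close>, which can be any vector. The
  variables \<open>p\<^sub>i\<close> with \<open>i > k\<close> occur in neither polynomial.
\<close>

lemma is_hirzebruch_L_lookup: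
  assumes L: "is_hirzebruch_L k L"
  shows "complex_of_real (if J \<in> monom_of ` compositions k then L_coeff k J else 0) = of_rat (Poly_Mapping.lookup L J)"
proof -
  let ?W = "monom_of ` compositions k"
  let ?K = "Poly_Mapping.keys L"
  let ?c = "\<lambda>J. complex_of_real (if J \<in> ?W then L_coeff k J else 0) - of_rat (Poly_Mapping.lookup L J)"
  have keys: "Poly_Mapping.keys J \<subseteq> {1..k}" if "J \<in> ?W \<union> ?K" for J
    using that L set_composition[of _ k] unfolding is_hirzebruch_L_def
    by (fastforce simp: keys_monom_of)
  have zero: "(\<Sum>J\<in>?W \<union> ?K. ?c J * monom_eval p J) = 0" for p
  proof -
    obtain x where x: "esym_eval k x j = p j" if "j \<in> {1..k}" for j
      using exists_esym_eval_eq[of k p] by blast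
    have eval: "monom_eval p J = monom_eval (esym_eval k x) J" if "J \<in> ?W \<union> ?K" for J
      using keys[OF that] by (intro monom_eval_cong) (auto simp: x subset_iff)
    have "(\<Sum>J\<in>?W \<union> ?K. ?c J * monom_eval p J) =
        (\<Sum>J\<in>?W \<union> ?K. of_real (if J \<in> ?W then L_coeff k J else 0) * monom_eval (esym_eval k x) J) -
        (\<Sum>J\<in>?W \<union> ?K. of_rat (Poly_Mapping.lookup L J) * monom_eval (esym_eval k x) J)"
      unfolding sum_subtractf[symmetric] by (intro sum.cong refl) (simp add: eval left_diff_distrib)
    also have "(\<Sum>J\<in>?W \<union> ?K. of_real (if J \<in> ?W then L_coeff k J else 0) * monom_eval (esym_eval k x) J) =
        (\<Sum>J\<in>?W. of_real (L_coeff k J) * monom_eval (esym_eval k x) J)"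
      by (rule sum.mono_neutral_cong_right) auto
    also have "(\<Sum>J\<in>?W \<union> ?K. of_rat (Poly_Mapping.lookup L J) * monom_eval (esym_eval k x) J) =
        mpoly_eval (esym_eval k x) L"
      by (rule mpoly_eval_superset[symmetric]) auto
    also have "\<dots> = mpoly_eval x (mpoly_subst (elem_sym k) L)"
      by (simp add: mpoly_eval_subst mpoly_eval_elem_sym)
    also have "\<dots> = mpoly_eval x (hirzebruch_part k k)"
      using L by (simp add: is_hirzebruch_L_def)
    finally show ?thesis by (simp only: L_coeff_sum_eq diff_self)
  qed
  have "?c J = 0"
  proof (cases "J \<in> ?W \<union> ?K")
    case True
    show ?thesis by (rule monom_evals_linearly_independent[OF _ zero True]) simp
  next
    case False
    thus ?thesis by (simp add: in_keys_iff)
  qed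
  thus ?thesis by simp
qed

section \<open>Existence of a rational solution\<close>

text \<open>
  The set \<open>{1}\<close> extends to a basis of \<open>\<real>\<close> over \<open>\<rat>\<close>, so there is a linear map with value \<open>1\<close> at \<open>1\<close>.
\<close>

lemma exists_rat_linear_retraction:
  "\<exists>\<pi> :: real \<Rightarrow> rat. (\<forall>a b. \<pi> (a + b) = \<pi> a + \<pi> b) \<and>
     (\<forall>q a. \<pi> (a * of_rat q) = \<pi> a * q) \<and> (\<forall>q. \<pi> (of_rat q) = q)"
proof -
  interpret vector_space_pair "\<lambda>(q :: rat) (a :: real). of_rat q * a" "\<lambda>(q :: rat) (a :: rat). q * a"
    by unfold_locales (auto simp: algebra_simps of_rat_add of_rat_mult)
  have "vs1.independent {1 :: real}"
    by (simp add: vs1.independent_insert vs1.span_empty)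
  then obtain \<pi> where "Vector_Spaces.linear (\<lambda>(q :: rat) (a :: real). of_rat q * a) (\<lambda>(q :: rat) (a :: rat). q * a) \<pi>"
    and one: "\<pi> 1 = 1"
    using linear_independent_extend[of "{1}" "\<lambda>_. 1"] by auto
  then interpret l: Vector_Spaces.linear "\<lambda>(q :: rat) (a :: real). of_rat q * a" "\<lambda>(q :: rat) (a :: rat). q * a" \<pi>
    by simp
  have "\<pi> (a * of_rat q) = \<pi> a * q" for a q
    using l.scale[of q a] by (simp add: mult.commute)
  moreover from this[of 1] have "\<pi> (of_rat q) = q" for q
    by (simp add: one)
  ultimately show ?thesis using l.add by blast
qed

lemma mpoly_eval_of_rat: "mpoly_eval (\<lambda>i. of_rat (x i)) P = of_rat (mpoly_eval x P)"
  by (simp add: mpoly_eval_def of_rat_sum of_rat_mult monom_eval_of_rat)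

lemma of_real_of_rat: "complex_of_real (of_rat q) = of_rat q"
  by (cases q) (simp add: of_rat_rat)

text \<open>
  At a rational point the equation satisfied by the real coefficients \<open>L_coeff k J\<close> is linear over \<open>\<rat>\<close>,
  with a rational right-hand side. A \<open>\<rat>\<close>-linear retraction of \<open>\<real>\<close> onto \<open>\<rat>\<close> therefore maps the
  coefficients to a rational solution.
\<close>

lemma exists_hirzebruch_L: "\<exists>L. is_hirzebruch_L k L"
proof -
  let ?W = "monom_of ` compositions k"
  obtain \<pi> :: "real \<Rightarrow> rat" where add: "\<And>a b. \<pi> (a + b) = \<pi> a + \<pi> b"
    and mult: "\<And>q a. \<pi> (a * of_rat q) = \<pi> a * q" and of_rat: "\<And>q. \<pi> (of_rat q) = q"
    using exists_rat_linear_retraction by blast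
  have sum: "\<pi> (\<Sum>i\<in>I. f i) = (\<Sum>i\<in>I. \<pi> (f i))" for I and f :: "monom \<Rightarrow> real"
    using of_rat[of 0] by (induction I rule: infinite_finite_induct) (auto simp: add)
  define L where "L = (\<Sum>J\<in>?W. Poly_Mapping.single J (\<pi> (L_coeff k J)))"
  have "Poly_Mapping.keys L \<subseteq> ?W"
  proof
    fix J assume "J \<in> Poly_Mapping.keys L"
    show "J \<in> ?W"
    proof (rule ccontr)
      assume "J \<notin> ?W"
      hence "Poly_Mapping.lookup L J = 0"
        unfolding L_def lookup_sum by (intro sum.neutral) (auto simp: lookup_single when_def)
      with \<open>J \<in> Poly_Mapping.keys L\<close> show False by (simp add: in_keys_iff)
    qed
  qed
  hence "\<forall>J\<in>Poly_Mapping.keys L. Poly_Mapping.keys J \<subseteq> {1..k}"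
    using set_composition by (fastforce simp: keys_monom_of)
  moreover have "mpoly_subst (elem_sym m) L = hirzebruch_part m k" for m
  proof (rule rat_mpoly_eqI)
    fix x :: "nat \<Rightarrow> rat"
    let ?e = "\<lambda>J. monom_eval (esym_eval m x) J"
    have "complex_of_real (\<Sum>J\<in>?W. L_coeff k J * of_rat (?e J)) =
        (\<Sum>J\<in>?W. of_real (L_coeff k J) * monom_eval (esym_eval m (\<lambda>i. of_rat (x i))) J)"
    proof -
      have "esym_eval m (\<lambda>i. of_rat (x i) :: complex) = (\<lambda>j. of_rat (esym_eval m x j))"
        by (simp add: esym_eval_of_rat fun_eq_iff)
      thus ?thesis by (simp add: monom_eval_of_rat of_real_of_rat)
    qed
    also have "\<dots> = complex_of_real (of_rat (mpoly_eval x (hirzebruch_part m k)))"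
      unfolding L_coeff_sum_eq mpoly_eval_of_rat of_real_of_rat ..
    finally have "(\<Sum>J\<in>?W. L_coeff k J * of_rat (?e J)) = of_rat (mpoly_eval x (hirzebruch_part m k))"
      by (simp only: of_real_eq_iff)
    hence "\<pi> (\<Sum>J\<in>?W. L_coeff k J * of_rat (?e J)) = mpoly_eval x (hirzebruch_part m k)"
      by (simp only: of_rat)
    thus "mpoly_eval x (mpoly_subst (elem_sym m) L) = mpoly_eval x (hirzebruch_part m k)"
      by (simp add: sum mult L_def mpoly_eval_subst mpoly_eval_sum mpoly_eval_elem_sym)
  qed
  ultimately show ?thesis unfolding is_hirzebruch_L_def by blast
qed

lemma hirzebruch_L_lookup:
  assumes "J \<in> monom_of ` compositions k"
  shows "of_rat (Poly_Mapping.lookup (hirzebruch_L k) J) = L_coeff k J"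
proof -
  obtain L where L: "is_hirzebruch_L k L" using exists_hirzebruch_L by blast
  have "L' = L" if "is_hirzebruch_L k L'" for L'
  proof (rule poly_mapping_eqI)
    fix J
    have "of_rat (Poly_Mapping.lookup L' J) = (of_rat (Poly_Mapping.lookup L J) :: complex)"
      using is_hirzebruch_L_lookup[OF that, of J] is_hirzebruch_L_lookup[OF L, of J] by metis
    thus "Poly_Mapping.lookup L' J = Poly_Mapping.lookup L J" by simp
  qed
  with L have "hirzebruch_L k = L"
    unfolding hirzebruch_L_def by (intro the_equality)
  with is_hirzebruch_L_lookup[OF L, of J] assms
  have "complex_of_real (of_rat (Poly_Mapping.lookup (hirzebruch_L k) J)) = of_real (L_coeff k J)"
    by (simp add: of_real_of_rat)
  thus ?thesis by (simp only: of_real_eq_iff)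
qed

section \<open>Symmetrization\<close>

text \<open>
  The permutations producing a given rearrangement \<open>ys\<close> form a coset of the stabilizer of \<open>xs\<close>, so
  their number does not depend on \<open>ys\<close>. It is \<open>r!\<close> divided by the number of rearrangements.
\<close>

lemma sum_permute_list:
  fixes f :: "'b list \<Rightarrow> 'a::field_char_0"
  shows "(\<Sum>\<sigma> | \<sigma> permutes {..<length xs}. f (permute_list \<sigma> xs)) =
    (\<Prod>x\<in>set xs. fact (count_list xs x)) * (\<Sum>ys | mset ys = mset xs. f ys)"
proof -
  let ?P = "{\<sigma>. \<sigma> permutes {..<length xs}}" and ?M = "permutations_of_multiset (mset xs)"
  let ?F = "\<lambda>ys. {\<sigma>. \<sigma> permutes {..<length xs} \<and> permute_list \<sigma> xs = ys}"
  have M: "{ys. mset ys = mset xs} = ?M" by (simp add: permutations_of_multiset_def)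
  have fin: "finite ?P" by (rule finite_permutations) simp
  have card_F: "card (?F ys) = card (?F xs)" if "ys \<in> ?M" for ys
  proof -
    from that have "mset ys = mset xs" by (rule permutations_of_multisetD)
    then obtain p where p: "p permutes {..<length xs}" "permute_list p xs = ys"
      by (rule mset_eq_permutation)
    note ip = permutes_inv[OF p(1)]
    have "permute_list (inv p) ys = xs"
      using permute_list_compose[OF ip, of p] permutes_inv_o(1)[OF p(1)] p(2) by simp
    have "bij_betw (\<lambda>\<sigma>. \<sigma> \<circ> p) (?F xs) (?F ys)"
    proof (rule bij_betwI[where g = "\<lambda>\<tau>. \<tau> \<circ> inv p"])
      show "(\<lambda>\<sigma>. \<sigma> \<circ> p) \<in> ?F xs \<rightarrow> ?F ys"
        using p by (auto simp: permutes_compose permute_list_compose)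
      show "(\<lambda>\<tau>. \<tau> \<circ> inv p) \<in> ?F ys \<rightarrow> ?F xs"
        using ip \<open>permute_list (inv p) ys = xs\<close> by (auto simp: permutes_compose permute_list_compose)
    qed (auto simp: o_assoc[symmetric] permutes_inv_o[OF p(1)])
    thus ?thesis by (rule bij_betw_same_card[symmetric])
  qed
  have group: "(\<Sum>\<sigma>\<in>?P. g (permute_list \<sigma> xs)) = of_nat (card (?F xs)) * (\<Sum>ys\<in>?M. g ys)"
    for g :: "'b list \<Rightarrow> 'a"
  proof -
    have "(\<Sum>\<sigma>\<in>?P. g (permute_list \<sigma> xs)) =
        (\<Sum>ys\<in>?M. \<Sum>\<sigma> | \<sigma> \<in> ?P \<and> permute_list \<sigma> xs = ys. g (permute_list \<sigma> xs))"
      using fin by (intro sum.group[symmetric]) (auto intro!: permutations_of_multisetI)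
    also have "\<dots> = (\<Sum>ys\<in>?M. of_nat (card (?F xs)) * g ys)"
      by (intro sum.cong refl) (simp add: card_F)
    finally show ?thesis by (simp add: sum_distrib_left)
  qed
  have "fact (length xs) = of_nat (card (?F xs)) * (of_nat (card ?M) :: 'a)"
    using group[of "\<lambda>_. 1"] card_permutations[of "{..<length xs}" "length xs"] by simp
  also have "fact (length xs) = (of_nat (card ?M) :: 'a) * (\<Prod>x\<in>set xs. fact (count_list xs x))"
    using arg_cong[OF card_permutations_of_multiset_aux[of "mset xs"], of "of_nat :: nat \<Rightarrow> 'a"]
    by (simp add: count_mset)
  finally have "of_nat (card (?F xs)) = ((\<Prod>x\<in>set xs. fact (count_list xs x)) :: 'a)"
    by (simp add: mult.commute card_eq_0_iff)
  with group[of f] show ?thesis by (simp add: M)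
qed

theorem theorem1:
  fixes k :: nat and js :: "nat list"
  assumes "k \<ge> 1" and "is_partition k js"
  shows "real_of_rat (hirzebruch_coeff k js) =
    (-1) ^ length js / (\<Prod>l=1..k. fact (count_list js l)) *
    (2 ^ (2 * k) / pi ^ (2 * k)) * T_Sigma (map (\<lambda>j. real (2 * j)) js)"
proof -
  let ?D = "\<lambda>s. map (\<lambda>j. real (2 * j)) s"
  have js: "js \<in> compositions k" using assms(2) by (simp add: is_partition_def compositions_def)
  have orbit: "{s. s \<in> compositions k \<and> monom_of s = monom_of js} = {s. mset s = mset js}"
  proof -
    have "s \<in> compositions k" if "mset s = mset js" for s
    proof -
      have "set s = set js" "sum_list s = sum_list js"
        using that by (metis set_mset_mset, metis sum_mset_sum_list)
      thus ?thesis using js by (simp add: compositions_def)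
    qed
    thus ?thesis by (auto simp: monom_of_eq_iff)
  qed
  have const: "(4 / pi ^ 2) ^ k = 2 ^ (2 * k) / pi ^ (2 * k)"
    by (simp add: power_divide power_mult)
  have "real_of_rat (hirzebruch_coeff k js) = L_coeff k (monom_of js)"
    unfolding hirzebruch_coeff_def monom_of_def[symmetric] using js by (intro hirzebruch_L_lookup) simp
  also have "\<dots> = (\<Sum>s | mset s = mset js. (-1) ^ length js * (2 ^ (2 * k) / pi ^ (2 * k)) * T (?D s))"
    unfolding L_coeff_def orbit const
    by (intro sum.cong refl) (auto dest: mset_eq_length)
  also have "\<dots> = (-1) ^ length js * (2 ^ (2 * k) / pi ^ (2 * k)) * (\<Sum>s | mset s = mset js. T (?D s))"
    by (simp only: sum_distrib_left)
  finally have coeff: "real_of_rat (hirzebruch_coeff k js) =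
      (-1) ^ length js * (2 ^ (2 * k) / pi ^ (2 * k)) * (\<Sum>s | mset s = mset js. T (?D s))" .
  have "T_Sigma (?D js) = (\<Sum>\<sigma> | \<sigma> permutes {..<length js}. T (?D (permute_list \<sigma> js)))"
    by (simp add: T_Sigma_def permute_list_map)
  also have "\<dots> = (\<Prod>l\<in>set js. fact (count_list js l)) * (\<Sum>s | mset s = mset js. T (?D s))"
    by (rule sum_permute_list)
  also have "(\<Prod>l\<in>set js. fact (count_list js l) :: real) = (\<Prod>l=1..k. fact (count_list js l))"
    using set_composition[OF js] by (intro prod.mono_neutral_left) (auto simp: count_list_0_iff)
  finally have "T_Sigma (?D js) =
      (\<Prod>l=1..k. fact (count_list js l)) * (\<Sum>s | mset s = mset js. T (?D s))" .
  with coeff show ?thesis by simp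
qed

end
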